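(* Let $F$ be a field of characteristic $0$ and let $\mathcal{U}=\{\pmb{\mathcal{U}}_i\}_{i\in\mathbb{N}}$ be a basis of the $F_{\mathcal{S}^{\ast}}$-module $F_{\mathcal{S}^{\ast}}\langle\mathcal{T}\rangle$. Assume that $\mathcal{U}$ is contained in the $F$-vector space spanned by $\mathcal{T}$. Then: 1. For every nonnegative integer $i$, there exists a polynomial $P_i(X)\in F[X]$ such that $\pmb{\mathcal{U}}_i=(P_i(k))_{k\ge0}$. 2. $\widetilde{\theta}(\pmb{\mathcal{U}}_i)=(P_i(-k))_{k\ge0}$ for every nonnegative integer $i$. 3. Let $A\in M_q(F)$ be a square matrix whose characteristic polynomial splits over $F$, and let $$\pmb{A}=\pmb{N}(A)+\pmb{\mathcal{B}}_0(P_0(k))_k+\cdots+\pmb{\mathcal{B}}_m(P_m(k))_k$$ be the $\mathcal{P}$-canonical form of $A$ relative to $(\mathcal{S}^{\ast},\mathcal{U})$. Then the sequence of matrices obtained by plugging $-k$ for $k$ in the geometric part $\pmb{\mathcal{B}}_0(P_0(k))_k+\cdots+\pmb{\mathcal{B}}_m(P_m(k))_k$ of $A$ is $\pmb{A}_d-\pi_0\pmb{0}_0$, where $\pmb{A}_d=(A_d^k)_{k\ge0}$, $A_d$ is the Drazin inverse of $A$, and $\pi_0$ is the spectral projection of $A$ at $0$.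
   Context: $\mathcal{C}_F$ is the $F$-algebra of all sequences over $F$ indexed by $k\ge0$, with componentwise operations; sequences of $q\times q$ matrices over $F$ are identified with elements of $M_q(\mathcal{C}_F)$; zeroth powers of matrices are $I_q$. For $\lambda\in F\setminus\{0\}$, $\pmb{\lambda}=(\lambda^k)_{k\ge0}$; $\mathcal{S}^{\ast}=\{\pmb{\lambda}:\lambda\in F,\lambda\ne0\}$; for $i\in\mathbb{N}$, $\pmb{0}_i$ is the sequence with $\pmb{0}_i(k)=\delta_{ik}$; $\mathcal{S}^{\circ}=\{\pmb{0}_i:i\ge0\}$. $F_{\mathcal{S}^{\ast}}$ (a subalgebra of $\mathcal{C}_F$) and $F_{\mathcal{S}^{\circ}}$ are the $F$-spans of $\mathcal{S}^{\ast}$ (a basis of the first) and $\mathcal{S}^{\circ}$. For $i\ge0$, $\pmb{\Lambda}_i=(\binom{k}{i})_{k\ge0}$, $\widetilde{\pmb{\Lambda}}_i=(\binom{-k}{i})_{k\ge0}$, $\mathcal{T}=\{\pmb{\Lambda}_i:i\ge0\}$, and $F_{\mathcal{S}^{\ast}}\langle\mathcal{T}\rangle$ is the $F_{\mathcal{S}^{\ast}}$-submodule of $\mathcal{C}_F$ spanned by $\mathcal{T}$; it is free with basis $\mathcal{T}$. $\theta:F_{\mathcal{S}^{\ast}}\to F_{\mathcal{S}^{\ast}}$ is the linear map with $\theta(\pmb{\lambda})=(\lambda^{-k})_{k\ge0}$. On $F_{\mathcal{S}^{\ast}}\langle\mathcal{T}\rangle$ the map $\widetilde{\theta}$ is given by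 $\widetilde{\theta}(\sum_i\pmb{w}_i\pmb{\Lambda}_i)=\sum_i\theta(\pmb{w}_i)\widetilde{\pmb{\Lambda}}_i$ ($\pmb{w}_i\in F_{\mathcal{S}^{\ast}}$), so that $\widetilde{\theta}(\pmb{\Lambda}_i)=\widetilde{\pmb{\Lambda}}_i$. For $A\in M_q(F)$ with characteristic polynomial split over $F$, $\pmb{A}=(A^k)_{k\ge0}$ can be written uniquely (up to zero terms) as $\pmb{N}(A)+\pmb{\mathcal{B}}_0\pmb{\mathcal{U}}_0+\cdots+\pmb{\mathcal{B}}_m\pmb{\mathcal{U}}_m$ with $\pmb{N}(A)\in M_q(F_{\mathcal{S}^{\circ}})$ (non-geometric part) and $\pmb{\mathcal{B}}_i\in M_q(F_{\mathcal{S}^{\ast}})$ (the rest being the geometric part); this is the $\mathcal{P}$-canonical form of $A$ relative to $(\mathcal{S}^{\ast},\mathcal{U})$. Plugging $-k$ for $k$ in the geometric part means replacing each $(\lambda^k)_k$ occurring in the entries of the $\pmb{\mathcal{B}}_i$ by $(\lambda^{-k})_k$ and each $(P_i(k))_k$ by $(P_i(-k))_k$. $\pi_0$ is the projection onto the generalized eigenspace of $A$ at $0$ along the sum of the generalized eigenspaces at nonzero eigenvalues ($\pi_0=0$ if $A$ is nonsingular). The Drazin inverse $A_d$ is the unique matrix $B$ with $A^{k}BA=A^{k}$ for some $k\ge0$, $AB=BA$, $BAB=B$. *)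

theory Defs
  imports
    "HOL-Library.Function_Algebras"
    "Jordan_Normal_Form.Char_Poly"
    "Jordan_Normal_Form.Matrix_Kernel"
begin

section \<open>Sequences over a field\<close>

text \<open>The algebra of all sequences over \<open>F\<close> is the type \<open>nat \<Rightarrow> 'a\<close> with the pointwise ring structure of
  \<open>Function_Algebras\<close>; the scalar multiplication by \<open>F\<close> is \<open>seq_scale\<close>.\<close>

definition seq_scale :: "'a::field \<Rightarrow> (nat \<Rightarrow> 'a) \<Rightarrow> nat \<Rightarrow> 'a" where
  "seq_scale c f = (\<lambda>k. c * f k)"

interpretation seq: vector_space seq_scale
  by unfold_locales (auto simp: seq_scale_def algebra_simps fun_eq_iff)

interpretation seq_pair: vector_space_pair seq_scale seq_scale
  by unfold_locales

definition geom_seq :: "'a::field \<Rightarrow> nat \<Rightarrow> 'a" where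
  "geom_seq a = (\<lambda>k. a ^ k)"

definition Sstar :: "(nat \<Rightarrow> 'a::field) set" where
  "Sstar = {geom_seq a | a. a \<noteq> 0}"

definition zero_seq :: "nat \<Rightarrow> nat \<Rightarrow> 'a::field" where
  "zero_seq i = (\<lambda>k. if k = i then 1 else 0)"

definition Scirc :: "(nat \<Rightarrow> 'a::field) set" where
  "Scirc = range zero_seq"

definition FSstar :: "(nat \<Rightarrow> 'a::field) set" where
  "FSstar = seq.span Sstar"

definition FScirc :: "(nat \<Rightarrow> 'a::field) set" where
  "FScirc = seq.span Scirc"

definition Lam :: "nat \<Rightarrow> nat \<Rightarrow> 'a::field_char_0" where
  "Lam i = (\<lambda>k. of_nat (k choose i))"

definition Lam_neg :: "nat \<Rightarrow> nat \<Rightarrow> 'a::field_char_0" where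
  "Lam_neg i = (\<lambda>k. (- of_nat k) gchoose i)"

definition T_set :: "(nat \<Rightarrow> 'a::field_char_0) set" where
  "T_set = range Lam"


section \<open>Modules over a subring\<close>

text \<open>Here \<open>R\<close> is (the carrier of) a subring of a commutative ring, which is viewed as an \<open>R\<close>-module.
  A basis is an indexed family, so linear independence includes injectivity of the family.\<close>

definition module_span :: "'r::comm_ring_1 set \<Rightarrow> 'r set \<Rightarrow> 'r set" where
  "module_span R X = {\<Sum>x\<in>I. w x * x | I w. finite I \<and> I \<subseteq> X \<and> (\<forall>x\<in>I. w x \<in> R)}"

definition module_independent :: "'r::comm_ring_1 set \<Rightarrow> (nat \<Rightarrow> 'r) \<Rightarrow> bool" where
  "module_independent R V \<longleftrightarrow>
     (\<forall>I w. finite I \<and> (\<forall>i\<in>I. w i \<in> R) \<and> (\<Sum>i\<in>I. w i * V i) = 0 \<longrightarrow> (\<forall>i\<in>I. w i = 0))"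

definition module_basis :: "'r::comm_ring_1 set \<Rightarrow> 'r set \<Rightarrow> (nat \<Rightarrow> 'r) \<Rightarrow> bool" where
  "module_basis R M V \<longleftrightarrow> range V \<subseteq> M \<and> module_span R (range V) = M \<and> module_independent R V"

definition module_coords :: "'r::comm_ring_1 set \<Rightarrow> (nat \<Rightarrow> 'r) \<Rightarrow> 'r \<Rightarrow> nat \<Rightarrow> 'r" where
  "module_coords R V x =
     (THE w. (\<forall>i. w i \<in> R) \<and> finite {i. w i \<noteq> 0} \<and> x = (\<Sum>i | w i \<noteq> 0. w i * V i))"

definition FSstarT :: "(nat \<Rightarrow> 'a::field_char_0) set" where
  "FSstarT = module_span FSstar T_set"


section \<open>The maps replacing \<open>k\<close> by \<open>-k\<close>\<close>

text \<open>\<open>theta\<close> is the linear extension from the basis \<open>Sstar\<close> of \<open>FSstar\<close> of the map sending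
  \<open>(a\<^sup>k)\<close> to \<open>(a\<^sup>-\<^sup>k)\<close>, the pointwise inverse of \<open>(a\<^sup>k)\<close>. The operator \<open>construct\<close> yields a map on all
  sequences; only its values on \<open>FSstar\<close> are meaningful.\<close>

definition theta :: "(nat \<Rightarrow> 'a::field) \<Rightarrow> nat \<Rightarrow> 'a" where
  "theta = seq_pair.construct Sstar (\<lambda>s k. inverse (s k))"

text \<open>Only meaningful on \<open>FSstarT\<close>, where the coordinates relative to the basis \<open>Lam\<close> exist and are
  unique.\<close>

definition theta_tilde :: "(nat \<Rightarrow> 'a::field_char_0) \<Rightarrow> nat \<Rightarrow> 'a" where
  "theta_tilde x =
     (\<Sum>i | module_coords FSstar Lam x i \<noteq> 0. theta (module_coords FSstar Lam x i) * Lam_neg i)"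


section \<open>Sequences of matrices\<close>

text \<open>A sequence of \<open>q \<times> q\<close> matrices is identified with a matrix of sequences.\<close>

definition seq_mat :: "nat \<Rightarrow> (nat \<Rightarrow> 'a mat) \<Rightarrow> (nat \<Rightarrow> 'a) mat" where
  "seq_mat q M = mat q q (\<lambda>(a, b) k. M k $$ (a, b))"

definition mat_over :: "nat \<Rightarrow> 'r set \<Rightarrow> 'r mat set" where
  "mat_over q R = {M \<in> carrier_mat q q. elements_mat M \<subseteq> R}"

text \<open>The matrix \<open>B\<^sub>0 V\<^sub>0 + \<dots> + B\<^sub>m V\<^sub>m\<close> (the type of matrices, of arbitrary dimensions, has no \<open>sum\<close>).\<close>

definition mat_lincomb :: "nat \<Rightarrow> nat \<Rightarrow> (nat \<Rightarrow> 'r::comm_ring_1 mat) \<Rightarrow> (nat \<Rightarrow> 'r) \<Rightarrow> 'r mat" where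
  "mat_lincomb q m B V = mat q q (\<lambda>(a, b). \<Sum>i\<le>m. B i $$ (a, b) * V i)"

definition P_canonical_form ::
  "(nat \<Rightarrow> nat \<Rightarrow> 'a::field_char_0) \<Rightarrow> nat \<Rightarrow> 'a mat \<Rightarrow> (nat \<Rightarrow> 'a) mat \<Rightarrow> nat \<Rightarrow> (nat \<Rightarrow> (nat \<Rightarrow> 'a) mat) \<Rightarrow> bool"
where
  "P_canonical_form U q A N m B \<longleftrightarrow>
     N \<in> mat_over q FScirc \<and> (\<forall>i\<le>m. B i \<in> mat_over q FSstar) \<and>
     seq_mat q (\<lambda>k. A ^\<^sub>m k) = N + mat_lincomb q m B U"


section \<open>Spectral projection at zero and Drazin inverse\<close>

definition splits :: "'a::field poly \<Rightarrow> bool" where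
  "splits p \<longleftrightarrow> (\<exists>c as. p = Polynomial.smult c (\<Prod>a\<leftarrow>as. [:- a, 1:]))"

definition gen_eigenspace :: "'a::field mat \<Rightarrow> 'a \<Rightarrow> 'a vec set" where
  "gen_eigenspace A e = (\<Union>j. mat_kernel (char_matrix A e ^\<^sub>m j))"

text \<open>The sum of the generalized eigenspaces at nonzero eigenvalues, as the span of their union.\<close>

definition nonzero_gen_eigenspaces :: "'a::field mat \<Rightarrow> 'a vec set" where
  "nonzero_gen_eigenspaces A =
     LinearCombinations.module.span class_ring (module_vec TYPE('a) (dim_row A))
       (\<Union>e\<in>{e. eigenvalue A e \<and> e \<noteq> 0}. gen_eigenspace A e)"

text \<open>The description below determines the matrix when the characteristic polynomial splits, since then
  the two subspaces are complementary.\<close>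

definition spectral_projection_0 :: "'a::field mat \<Rightarrow> 'a mat" where
  "spectral_projection_0 A =
     (THE P. P \<in> carrier_mat (dim_row A) (dim_row A) \<and>
        (\<forall>x \<in> gen_eigenspace A 0. \<forall>y \<in> nonzero_gen_eigenspaces A. P *\<^sub>v (x + y) = x))"

definition drazin_inverse :: "'a::field mat \<Rightarrow> 'a mat" where
  "drazin_inverse A =
     (THE B. B \<in> carrier_mat (dim_row A) (dim_row A) \<and>
        (\<exists>k. A ^\<^sub>m k * B * A = A ^\<^sub>m k) \<and> A * B = B * A \<and> B * A * B = B)"

end

theory Submission
  imports Defs
begin

text \<open>The idea is to continue everything from the natural numbers to the integers. Call a sequence
  \<open>g :: int \<Rightarrow> 'a\<close> recurrent (\<open>linrec\<close>) if it is annihilated by a polynomial \<open>h\<close> in the shift operator that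
  splits and has only nonzero roots. Such a recurrence can also be run backwards, so \<open>g\<close> is determined by
  its values at all large indices (\<open>shift_act_split_poly_eq_0\<close>).

  A geometric part \<open>B\<^sub>0 (P\<^sub>0(k)) + \<dots> + B\<^sub>m (P\<^sub>m(k))\<close> has a natural continuation to the integers, using
  integer powers of the bases and the values of the \<open>P\<^sub>i\<close> at integers. Its entries are recurrent, and its
  value at \<open>-k\<close> is what plugging \<open>-k\<close> for \<open>k\<close> means. If it is the geometric part of \<open>(A\<^sup>k)\<close>, it agrees with
  \<open>A\<^sup>k\<close> for all \<open>k \<ge> r\<close>, because the non-geometric part has finite support; hence a common annihilator
  \<open>h\<close> of the entries satisfies \<open>h(A) A\<^sup>r = 0\<close>.

  From this relation and a Bezout identity \<open>u X\<^bsup>r+1\<^esup> + w h = 1\<close> one gets the spectral projection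
  \<open>\<pi>\<^sub>0 = (w h)(A)\<close> and the Drazin inverse, again as a polynomial in \<open>A\<close> (locale \<open>core_nilpotent\<close>). The matrices
  \<open>G(k) = (1 - \<pi>\<^sub>0) A\<^sup>k\<close> for \<open>k \<ge> 0\<close> and \<open>G(-k) = A\<^sub>d\<^sup>k\<close> for \<open>k > 0\<close> satisfy \<open>G(k + 1) = A G(k)\<close> and
  \<open>h(A) G(k) = 0\<close> for all integers \<open>k\<close>, so their entries are annihilated by \<open>h\<close> too, and
  \<open>G(k) = A\<^sup>k\<close> for \<open>k > r\<close> (\<open>drazin_orbit\<close>). By the uniqueness above, \<open>G\<close> is the continuation of the geometric
  part, and comparing values at \<open>-k\<close> gives the third claim.

  The first two claims are a computation once the sequences \<open>a\<^sup>k (k choose j)\<close> with \<open>a \<noteq> 0\<close> are known to be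
  linearly independent (\<open>geom_binom_independent\<close>): this makes \<open>theta\<close> the intended map and makes the coordinates
  relative to \<open>Lam\<close> unique, so an \<open>F\<close>-combination of the \<open>Lam j\<close> is its own coordinate expansion.\<close>

section \<open>Polynomials in the shift operator\<close>

text \<open>The action of \<open>p\<close>, with the variable acting as the shift \<open>g \<mapsto> g(\<sqdot> + 1)\<close>, on sequences indexed by
  the integers.\<close>

definition shift_act :: "'a::comm_ring_1 poly \<Rightarrow> (int \<Rightarrow> 'a) \<Rightarrow> int \<Rightarrow> 'a" where
  "shift_act p g n = (\<Sum>i\<le>degree p. coeff p i * g (n + int i))"

lemma shift_act_0 [simp]: "shift_act 0 g = (\<lambda>n. 0)"
  by (simp add: shift_act_def fun_eq_iff)

lemma shift_act_pCons: "shift_act (pCons c p) g n = c * g n + shift_act p g (n + 1)"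
proof (cases "p = 0")
  case False
  then show ?thesis
    by (simp add: shift_act_def sum.atMost_Suc_shift add_ac del: sum.atMost_Suc)
qed (simp add: shift_act_def)

lemma shift_act_1 [simp]: "shift_act 1 g = g"
  by (simp add: fun_eq_iff one_pCons shift_act_pCons)

lemma shift_act_linear: "shift_act [:- a, 1:] g = (\<lambda>n. g (n + 1) - a * g n)"
  by (simp add: fun_eq_iff shift_act_pCons)

lemma shift_act_cong: "(\<And>k. k \<ge> n \<Longrightarrow> f k = g k) \<Longrightarrow> shift_act p f n = shift_act p g n"
  by (simp add: shift_act_def)

lemma shift_act_sum: "shift_act p (\<lambda>n. \<Sum>x\<in>I. c x * g x n) n = (\<Sum>x\<in>I. c x * shift_act p (g x) n)"
  by (simp add: shift_act_def sum_distrib_left mult.left_commute)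
    (rule sum.swap)

lemma shift_act_cmult: "shift_act p (\<lambda>n. c * g n) n = c * shift_act p g n"
  by (simp add: shift_act_def sum_distrib_left mult.left_commute)

lemma shift_act_zero_seq [simp]: "shift_act p (\<lambda>n. 0) = (\<lambda>n. 0)"
  by (simp add: shift_act_def fun_eq_iff)

lemma shift_act_diff: "shift_act p (\<lambda>n. f n - g n) n = shift_act p f n - shift_act p g n"
  by (simp add: shift_act_def algebra_simps sum_subtractf)

lemma shift_act_add_poly: "shift_act (p + q) g n = shift_act p g n + shift_act q g n"
  by (induction p q arbitrary: n rule: poly_induct2) (simp_all add: shift_act_pCons algebra_simps)

lemma shift_act_smult: "shift_act (Polynomial.smult c p) g n = c * shift_act p g n"
  by (induction p arbitrary: n) (simp_all add: shift_act_pCons algebra_simps)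

lemma shift_act_mult: "shift_act (p * q) g = shift_act p (shift_act q g)"
proof
  show "shift_act (p * q) g n = shift_act p (shift_act q g) n" for n
    by (induction p arbitrary: n)
      (simp_all add: shift_act_pCons shift_act_add_poly shift_act_smult)
qed

lemma shift_act_dvd: "p dvd q \<Longrightarrow> shift_act p g = (\<lambda>n. 0) \<Longrightarrow> shift_act q g = (\<lambda>n. 0)"
  by (auto simp: dvd_def shift_act_mult mult.commute)

text \<open>The product of the factors \<open>(X - a)\<^sup>d\<close> with \<open>a \<in> S\<close>. Using one exponent for all roots makes it easy to
  pass to a common multiple: enlarge \<open>S\<close> and \<open>d\<close>.\<close>

definition split_poly :: "'a::field set \<Rightarrow> nat \<Rightarrow> 'a poly" where
  "split_poly S d = (\<Prod>a\<in>S. [:- a, 1:] ^ d)"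

lemma split_poly_dvd:
  assumes "finite S'" "S \<subseteq> S'" "d \<le> d'"
  shows "split_poly S d dvd split_poly S' d'"
proof -
  have "split_poly S d dvd split_poly S d'"
    unfolding split_poly_def using assms(3) by (intro prod_dvd_prod le_imp_power_dvd)
  also have "\<dots> dvd split_poly S' d'"
    unfolding split_poly_def by (rule prod_dvd_prod_subset) (use assms in auto)
  finally show ?thesis .
qed

lemma poly_split_poly_eq_0_iff:
  "finite S \<Longrightarrow> poly (split_poly S d) x = 0 \<longleftrightarrow> d > 0 \<and> x \<in> S"
  by (auto simp: split_poly_def poly_prod)

text \<open>The sequence satisfies a linear recurrence with constant coefficients whose characteristic polynomial
  splits and has nonzero constant coefficient.\<close>

definition linrec :: "(int \<Rightarrow> 'a::field) \<Rightarrow> bool" where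
  "linrec g \<longleftrightarrow> (\<exists>S d. finite S \<and> 0 \<notin> S \<and> shift_act (split_poly S d) g = (\<lambda>n. 0))"

lemma linrec_common:
  assumes "finite I" "\<And>x. x \<in> I \<Longrightarrow> linrec (g x)"
  shows "\<exists>S d. finite S \<and> 0 \<notin> S \<and> (\<forall>x\<in>I. shift_act (split_poly S d) (g x) = (\<lambda>n. 0))"
proof -
  from assms(2) obtain S d where *:
    "\<And>x. x \<in> I \<Longrightarrow> finite (S x)" "\<And>x. x \<in> I \<Longrightarrow> 0 \<notin> S x"
    "\<And>x. x \<in> I \<Longrightarrow> shift_act (split_poly (S x) (d x)) (g x) = (\<lambda>n. 0)"
    unfolding linrec_def by metis
  have "shift_act (split_poly (\<Union>(S ` I)) (Max (d ` I))) (g x) = (\<lambda>n. 0)" if "x \<in> I" for x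
    by (rule shift_act_dvd[OF split_poly_dvd *(3)]) (use that assms(1) * in auto)
  then show ?thesis using assms(1) * by (intro exI[of _ "\<Union>(S ` I)"] exI) auto
qed

lemma linrec_lincomb:
  assumes "finite I" "\<And>x. x \<in> I \<Longrightarrow> linrec (g x)"
  shows "linrec (\<lambda>n. \<Sum>x\<in>I. c x * g x n)"
proof -
  from linrec_common[of I g] assms obtain S d where
    "finite S" "0 \<notin> S" "\<forall>x\<in>I. shift_act (split_poly S d) (g x) = (\<lambda>n. 0)"
    by blast
  then show ?thesis
    unfolding linrec_def by (intro exI[of _ S] exI[of _ d]) (simp add: fun_eq_iff shift_act_sum)
qed

lemma eq_0_if_linear_factor:
  fixes g :: "int \<Rightarrow> 'a::field"
  assumes a: "a \<noteq> 0" and rec: "shift_act [:- a, 1:] g = (\<lambda>n. 0)"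
    and zero: "\<And>n. n \<ge> n0 \<Longrightarrow> g n = 0"
  shows "g = (\<lambda>n. 0)"
proof
  have step: "g (n + 1) = a * g n" for n
    using fun_cong[OF rec, of n] by (simp add: shift_act_linear)
  have "\<forall>k. g (n0 - int k) = 0"
  proof
    fix k show "g (n0 - int k) = 0"
    proof (induction k)
      case (Suc k)
      then show ?case using step[of "n0 - int (Suc k)"] a by (simp add: algebra_simps)
    qed (simp add: zero)
  qed
  then show "g n = 0" for n
    using zero[of n] by (cases "n \<ge> n0") (auto dest: spec[of _ "nat (n0 - n)"] split: if_splits)
qed

text \<open>Uniqueness of the continuation of a recurrent sequence: since \<open>0 \<notin> S\<close>, each linear factor
  \<open>g(n + 1) = a g(n)\<close> of the recurrence can be solved for \<open>g(n)\<close>, so zeros at large indices propagate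
  downwards.\<close>

lemma shift_act_split_poly_eq_0:
  fixes g :: "int \<Rightarrow> 'a::field"
  assumes "finite S" "0 \<notin> S" "shift_act (split_poly S d) g = (\<lambda>n. 0)"
    and "\<And>n. n \<ge> n0 \<Longrightarrow> g n = 0"
  shows "g = (\<lambda>n. 0)"
  using assms
proof (induction S arbitrary: g rule: finite_induct)
  case empty
  then show ?case by (simp add: split_poly_def)
next
  case (insert a S)
  have power: "shift_act ([:- a, 1:] ^ k) f = (\<lambda>n. 0) \<Longrightarrow> (\<And>n. n \<ge> n0 \<Longrightarrow> f n = 0) \<Longrightarrow> f = (\<lambda>n. 0)"
    for k and f :: "int \<Rightarrow> 'a"
  proof (induction k arbitrary: f)
    case (Suc k)
    have "shift_act [:- a, 1:] f = (\<lambda>n. 0)"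
    proof (rule Suc.IH)
      show "shift_act ([:- a, 1:] ^ k) (shift_act [:- a, 1:] f) = (\<lambda>n. 0)"
        using Suc.prems(1) by (metis power_Suc2 shift_act_mult)
    qed (simp add: shift_act_linear Suc.prems)
    then show ?case
      using insert.prems(1) Suc.prems(2) by (intro eq_0_if_linear_factor[of a f n0]) auto
  qed simp
  have "shift_act (split_poly S d) g = (\<lambda>n. 0)"
  proof (rule power)
    show "shift_act ([:- a, 1:] ^ d) (shift_act (split_poly S d) g) = (\<lambda>n. 0)"
      using insert by (simp add: split_poly_def shift_act_mult)
    show "shift_act (split_poly S d) g n = 0" if "n \<ge> n0" for n
      using that shift_act_cong[of n g "\<lambda>n. 0"] insert.prems(3) by simp
  qed
  then show ?case using insert by auto
qed

text \<open>The sequence \<open>a\<^sup>n (n choose j)\<close>, for all integers \<open>n\<close>. By Pascal's rule the operator \<open>X - a\<close> lowers \<open>j\<close> by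
  one, up to the factor \<open>a\<close>.\<close>

definition geom_binom :: "'a::field_char_0 \<Rightarrow> nat \<Rightarrow> int \<Rightarrow> 'a" where
  "geom_binom a j n = a powi n * (of_int n gchoose j)"

lemma shift_act_geom_binom_Suc:
  assumes "a \<noteq> 0"
  shows "shift_act [:- a, 1:] (geom_binom a (Suc j)) = (\<lambda>n. a * geom_binom a j n)"
proof
  show "shift_act [:- a, 1:] (geom_binom a (Suc j)) n = a * geom_binom a j n" for n
    using gbinomial_Suc_Suc[of "of_int n :: 'a" j] assms
    by (simp add: shift_act_linear geom_binom_def power_int_add_1 algebra_simps)
qed

lemma shift_act_geom_binom_0: "a \<noteq> 0 \<Longrightarrow> shift_act p (geom_binom a 0) = (\<lambda>n. poly p a * geom_binom a 0 n)"
proof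
  fix n assume a: "a \<noteq> 0"
  show "shift_act p (geom_binom a 0) n = poly p a * geom_binom a 0 n"
    by (induction p arbitrary: n)
      (simp_all add: shift_act_pCons geom_binom_def power_int_add_1 algebra_simps a)
qed

lemma shift_act_geom_binom_same:
  assumes "a \<noteq> 0"
  shows "shift_act ([:- a, 1:] ^ j) (geom_binom a j) = (\<lambda>n. a ^ j * geom_binom a 0 n)"
proof (induction j)
  case (Suc j)
  have "shift_act ([:- a, 1:] ^ Suc j) (geom_binom a (Suc j))
      = shift_act ([:- a, 1:] ^ j) (\<lambda>n. a * geom_binom a j n)"
    unfolding power_Suc2 shift_act_mult using assms by (simp add: shift_act_geom_binom_Suc)
  then show ?case using Suc by (simp add: fun_eq_iff shift_act_cmult)
qed simp

lemma shift_act_geom_binom_greater: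
  assumes "a \<noteq> 0" "j < d"
  shows "shift_act ([:- a, 1:] ^ d) (geom_binom a j) = (\<lambda>n. 0)"
proof (rule shift_act_dvd)
  show "[:- a, 1:] ^ Suc j dvd [:- a, 1:] ^ d"
    using assms(2) by (intro le_imp_power_dvd) auto
  show "shift_act ([:- a, 1:] ^ Suc j) (geom_binom a j) = (\<lambda>n. 0)"
    using assms unfolding power_Suc shift_act_mult shift_act_geom_binom_same[OF assms(1)]
    by (simp add: fun_eq_iff shift_act_cmult shift_act_geom_binom_0)
qed

lemma linrec_geom_binom:
  assumes "a \<noteq> 0" shows "linrec (geom_binom a j)"
  unfolding linrec_def
  by (rule exI[of _ "{a}"], rule exI[of _ "Suc j"])
    (use assms shift_act_geom_binom_greater[of a j "Suc j"] in \<open>simp add: split_poly_def\<close>)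

text \<open>The sequences \<open>a\<^sup>n (n choose j)\<close> with \<open>a \<noteq> 0\<close> are linearly independent, even when restricted to
  \<open>n \<ge> 0\<close>. For a base \<open>b\<close> and the largest \<open>d\<close> with \<open>c b d \<noteq> 0\<close>, the operator
  \<open>(X - b)\<^sup>d\<close> times high powers of \<open>X - a\<close> for all \<open>a \<noteq> b\<close> kills every term except the one for
  \<open>(b, d)\<close>, which becomes a nonzero multiple of \<open>b\<^sup>n\<close>.\<close>

lemma geom_binom_independent:
  assumes S: "finite S" "0 \<notin> S" and J: "finite J"
    and zero: "\<And>n. n \<ge> 0 \<Longrightarrow> (\<Sum>a\<in>S. \<Sum>j\<in>J. c a j * geom_binom a j n) = 0"
    and "b \<in> S" "i \<in> J"
  shows "c b i = 0"
proof (rule ccontr)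
  assume "c b i \<noteq> 0"
  define d where "d = Max {j \<in> J. c b j \<noteq> 0}"
  have "finite {j \<in> J. c b j \<noteq> 0}" "{j \<in> J. c b j \<noteq> 0} \<noteq> {}"
    using J \<open>c b i \<noteq> 0\<close> \<open>i \<in> J\<close> by auto
  from Max_in[OF this] have d: "d \<in> J" "c b d \<noteq> 0" by (auto simp: d_def)
  have above: "c b j = 0" if "j \<in> J" "j > d" for j
  proof (rule ccontr)
    assume "c b j \<noteq> 0"
    then have "j \<le> d" unfolding d_def using J that by (intro Max_ge) auto
    then show False using that by simp
  qed
  \<comment> \<open>An exponent that exceeds every \<open>j \<in> J\<close>, so that \<open>(X - a)\<^sup>D\<close> kills all terms with base \<open>a\<close>.\<close>
  define D where "D = Suc (Max J)"
  have D: "j < D" if "j \<in> J" for j using Max_ge[OF J that] by (simp add: D_def)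
  define q where "q = split_poly (S - {b}) D"
  define p where "p = q * [:- b, 1:] ^ d"
  have nz: "a \<noteq> 0" if "a \<in> S" for a using that S by auto
  have other: "shift_act p (geom_binom a j) = (\<lambda>n. 0)" if "a \<in> S" "a \<noteq> b" "j \<in> J" for a j
  proof (rule shift_act_dvd)
    have "[:- a, 1:] ^ D dvd q"
      unfolding q_def split_poly_def by (rule dvd_prodI) (use that S in auto)
    then show "[:- a, 1:] ^ D dvd p" by (simp add: p_def)
    show "shift_act ([:- a, 1:] ^ D) (geom_binom a j) = (\<lambda>n. 0)"
      using that D nz by (intro shift_act_geom_binom_greater) auto
  qed
  have own: "c b j * shift_act p (geom_binom b j) 0 = (if j = d then c b d * b ^ d * poly q b else 0)"
    if "j \<in> J" for j
  proof -
    consider "j < d" | "j = d" | "j > d" by linarith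
    then show ?thesis
    proof cases
      case 1
      then have "shift_act p (geom_binom b j) = (\<lambda>n. 0)"
        unfolding p_def using nz[OF \<open>b \<in> S\<close>]
        by (intro shift_act_dvd[OF dvd_triv_right] shift_act_geom_binom_greater)
      then show ?thesis using 1 by simp
    next
      case 2
      then show ?thesis
        using nz[OF \<open>b \<in> S\<close>]
        by (simp add: p_def shift_act_mult shift_act_geom_binom_same shift_act_cmult shift_act_geom_binom_0)
          (simp add: geom_binom_def)
    qed (use above that in auto)
  qed
  have "0 = shift_act p (\<lambda>n. \<Sum>a\<in>S. \<Sum>j\<in>J. c a j * geom_binom a j n) 0"
    using shift_act_cong[of 0 "\<lambda>n. \<Sum>a\<in>S. \<Sum>j\<in>J. c a j * geom_binom a j n" "\<lambda>n. 0" p] zero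
    by simp
  also have "\<dots> = (\<Sum>a\<in>S. \<Sum>j\<in>J. c a j * shift_act p (geom_binom a j) 0)"
    using shift_act_sum[of p "\<lambda>_. 1" "\<lambda>a n. \<Sum>j\<in>J. c a j * geom_binom a j n" S 0]
    by (simp add: shift_act_sum)
  also have "\<dots> = (\<Sum>a\<in>S. if a = b then \<Sum>j\<in>J. c b j * shift_act p (geom_binom b j) 0 else 0)"
    by (intro sum.cong) (auto simp: other)
  also have "\<dots> = (\<Sum>j\<in>J. c b j * shift_act p (geom_binom b j) 0)"
    using S \<open>b \<in> S\<close> by simp
  also have "\<dots> = (\<Sum>j\<in>J. if j = d then c b d * b ^ d * poly q b else 0)"
    by (intro sum.cong refl own)
  also have "\<dots> = c b d * b ^ d * poly q b"
    using J d by simp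
  finally have "0 = c b d * b ^ d * poly q b" .
  moreover have "poly q b \<noteq> 0"
    using S by (simp add: q_def poly_split_poly_eq_0_iff)
  ultimately show False
    using d nz[OF \<open>b \<in> S\<close>] by simp
qed

section \<open>Polynomials in a matrix\<close>

text \<open>The value of a polynomial at a square matrix. As matrices of arbitrary dimension carry no \<open>sum\<close>, it is
  given entrywise.\<close>

definition poly_mat :: "'a::comm_ring_1 mat \<Rightarrow> 'a poly \<Rightarrow> 'a mat" where
  "poly_mat A p = mat (dim_row A) (dim_row A)
     (\<lambda>(i, j). \<Sum>k\<le>degree p. coeff p k * (A ^\<^sub>m k) $$ (i, j))"

lemma poly_mat_dim [simp]: "dim_row (poly_mat A p) = dim_row A" "dim_col (poly_mat A p) = dim_row A"
  by (simp_all add: poly_mat_def)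

context
  fixes A :: "'a::comm_ring_1 mat" and n :: nat
  assumes A: "A \<in> carrier_mat n n"
begin

lemma poly_mat_carrier [simp]: "poly_mat A p \<in> carrier_mat n n"
  using A by (simp add: poly_mat_def)

lemma poly_mat_index_shift_act:
  assumes "i < n" "j < n"
  shows "poly_mat A p $$ (i, j) = shift_act p (\<lambda>k. (A ^\<^sub>m nat k) $$ (i, j)) 0"
  using A assms by (simp add: poly_mat_def shift_act_def)

lemma poly_mat_0: "poly_mat A 0 = 0\<^sub>m n n"
  using A by (intro eq_matI) (auto simp: poly_mat_def)

lemma poly_mat_add: "poly_mat A (p + q) = poly_mat A p + poly_mat A q"
  using carrier_matD[OF poly_mat_carrier]
  by (intro eq_matI) (auto simp: poly_mat_index_shift_act shift_act_add_poly)

lemma poly_mat_smult: "poly_mat A (Polynomial.smult c p) = c \<cdot>\<^sub>m poly_mat A p"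
  using carrier_matD[OF poly_mat_carrier]
  by (intro eq_matI) (auto simp: poly_mat_index_shift_act shift_act_smult)

lemma poly_mat_pCons: "poly_mat A (pCons c p) = c \<cdot>\<^sub>m 1\<^sub>m n + poly_mat A p * A"
proof (rule eq_matI)
  fix i j
  assume "i < dim_row (c \<cdot>\<^sub>m 1\<^sub>m n + poly_mat A p * A)" "j < dim_col (c \<cdot>\<^sub>m 1\<^sub>m n + poly_mat A p * A)"
  then have ij: "i < n" "j < n" using A by auto
  have "(poly_mat A p * A) $$ (i, j)
      = (\<Sum>l<n. (\<Sum>k\<le>degree p. coeff p k * (A ^\<^sub>m k) $$ (i, l)) * A $$ (l, j))"
    using A ij by (simp add: poly_mat_def scalar_prod_def atLeast0LessThan)
  also have "\<dots> = (\<Sum>k\<le>degree p. coeff p k * (\<Sum>l<n. (A ^\<^sub>m k) $$ (i, l) * A $$ (l, j)))"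
    unfolding sum_distrib_left sum_distrib_right by (subst sum.swap) (simp add: mult.assoc)
  also have "\<dots> = (\<Sum>k\<le>degree p. coeff p k * (A ^\<^sub>m Suc k) $$ (i, j))"
    using A ij by (intro sum.cong refl) (simp add: scalar_prod_def atLeast0LessThan)
  also have "\<dots> = shift_act p (\<lambda>k. (A ^\<^sub>m nat k) $$ (i, j)) 1"
    by (simp add: shift_act_def nat_add_distrib)
  finally show "poly_mat A (pCons c p) $$ (i, j) = (c \<cdot>\<^sub>m 1\<^sub>m n + poly_mat A p * A) $$ (i, j)"
    using A ij by (simp add: poly_mat_index_shift_act shift_act_pCons one_mat_def)
qed (use A in \<open>auto simp: poly_mat_def\<close>)

lemma poly_mat_pCons_0: "poly_mat A (pCons 0 p) = poly_mat A p * A"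
proof -
  have "0 \<cdot>\<^sub>m 1\<^sub>m n = (0\<^sub>m n n :: 'a mat)" by auto
  then show ?thesis
    by (simp add: poly_mat_pCons left_add_zero_mat[OF mult_carrier_mat[OF poly_mat_carrier A]])
qed

lemma poly_mat_1: "poly_mat A 1 = 1\<^sub>m n"
proof -
  have "1 \<cdot>\<^sub>m 1\<^sub>m n = (1\<^sub>m n :: 'a mat)" by auto
  then show ?thesis using A by (simp add: one_pCons poly_mat_pCons poly_mat_0)
qed

lemma poly_mat_mult: "poly_mat A (p * q) = poly_mat A p * poly_mat A q"
proof -
  \<comment> \<open>The induction on \<open>p\<close> produces the factors in reverse order; this is harmless as polynomials commute.\<close>
  have "poly_mat A (p * q) = poly_mat A q * poly_mat A p" for p q
  proof (induction p)
    case 0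
    then show ?case by (simp add: poly_mat_0 right_mult_zero_mat[OF poly_mat_carrier])
  next
    case (pCons c p)
    have "poly_mat A (pCons c p * q) = c \<cdot>\<^sub>m poly_mat A q + poly_mat A (p * q) * A"
      using A by (simp add: poly_mat_add poly_mat_smult poly_mat_pCons_0)
    also have "\<dots> = poly_mat A q * (c \<cdot>\<^sub>m 1\<^sub>m n) + poly_mat A q * (poly_mat A p * A)"
      using A assoc_mult_mat[OF poly_mat_carrier poly_mat_carrier A]
      by (simp add: pCons mult_smult_distrib[OF poly_mat_carrier one_carrier_mat]
        right_mult_one_mat[OF poly_mat_carrier])
    also have "\<dots> = poly_mat A q * poly_mat A (pCons c p)"
      unfolding poly_mat_pCons
      by (rule mult_add_distrib_mat[symmetric, OF poly_mat_carrier _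
            mult_carrier_mat[OF poly_mat_carrier A]]) simp
    finally show ?case .
  qed
  from this[of q p] show ?thesis by (simp add: mult.commute)
qed

lemma poly_mat_power: "poly_mat A (p ^ k) = poly_mat A p ^\<^sub>m k"
proof (induction k)
  case 0
  then show ?case using carrier_matD(1)[OF poly_mat_carrier[of p]] by (simp add: poly_mat_1)
next
  case (Suc k)
  then show ?case by (simp only: power_Suc2 poly_mat_mult pow_mat.simps)
qed

lemma poly_mat_X: "poly_mat A [:0, 1:] = A"
  using A by (simp add: poly_mat_pCons_0 poly_mat_1 flip: one_pCons)

lemma poly_mat_X_power: "poly_mat A ([:0, 1:] ^ k) = A ^\<^sub>m k"
  by (simp add: poly_mat_power poly_mat_X)

lemma pow_mat_Suc_left: "A ^\<^sub>m Suc k = A * A ^\<^sub>m k"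
  using poly_mat_mult[of "[:0, 1:]" "[:0, 1:] ^ k"]
  by (simp only: poly_mat_X_power poly_mat_X flip: power_Suc)

lemma poly_mat_eq_0:
  assumes "poly_mat A m = 0\<^sub>m n n" "m dvd p"
  shows "poly_mat A p = 0\<^sub>m n n"
  using assms
  by (auto simp: poly_mat_mult left_mult_zero_mat[OF poly_mat_carrier])

lemma poly_mat_cong:
  assumes "poly_mat A m = 0\<^sub>m n n" "m dvd p - q"
  shows "poly_mat A p = poly_mat A q"
proof -
  have "poly_mat A (q + (p - q)) = poly_mat A q + 0\<^sub>m n n"
    by (simp only: poly_mat_add poly_mat_eq_0[OF assms])
  then show ?thesis by (simp add: right_add_zero_mat[OF poly_mat_carrier])
qed

lemma poly_mat_commute:
  assumes B: "B \<in> carrier_mat n n" and AB: "A * B = B * A"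
  shows "poly_mat A p * B = B * poly_mat A p"
proof (induction p)
  case 0
  then show ?case using B by (simp add: poly_mat_0)
next
  case (pCons c p)
  note assoc = assoc_mult_mat[of _ n n _ n _ n]
  have "poly_mat A p * A * B = poly_mat A p * B * A"
    using A B by (simp add: assoc AB)
  also have "\<dots> = B * (poly_mat A p * A)"
    using A B by (simp add: pCons.IH assoc)
  finally have "poly_mat A p * A * B = B * (poly_mat A p * A)" .
  moreover have "B * (c \<cdot>\<^sub>m 1\<^sub>m n + poly_mat A p * A) = c \<cdot>\<^sub>m B + B * (poly_mat A p * A)"
    using A B mult_carrier_mat[OF poly_mat_carrier[of p] A]
    by (subst mult_add_distrib_mat[of _ n n _ n]) (simp_all add: mult_smult_distrib[of _ n n _ n])
  moreover have "(c \<cdot>\<^sub>m 1\<^sub>m n + poly_mat A p * A) * B = c \<cdot>\<^sub>m B + poly_mat A p * A * B"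
    using A B mult_carrier_mat[OF poly_mat_carrier[of p] A]
    by (subst add_mult_distrib_mat[of _ n n _ _ n]) (simp_all add: mult_smult_assoc_mat[of _ n n _ n])
  ultimately show ?case unfolding poly_mat_pCons by simp
qed

text \<open>On a solution of \<open>G(k + 1) = A G(k)\<close>, the shift operator acts entrywise as multiplication by \<open>A\<close> from
  the left. The recursion is only needed from some index \<open>m\<close> on, which covers both the powers
  \<open>A\<^sup>k\<close> with \<open>k \<ge> 0\<close> and sequences over all integers.\<close>

lemma shift_act_orbit:
  assumes G: "\<And>k. k \<ge> m \<Longrightarrow> G k \<in> carrier_mat n n" "\<And>k. k \<ge> m \<Longrightarrow> G (k + 1) = A * G k"
    and "i < n" "j < n" "k \<ge> m"
  shows "shift_act p (\<lambda>k. G k $$ (i, j)) k = (poly_mat A p * G k) $$ (i, j)"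
  using \<open>k \<ge> m\<close>
proof (induction p arbitrary: k)
  case 0
  then show ?case using assms(1)[of k] assms(3,4) by (simp add: poly_mat_0)
next
  case (pCons c p)
  have "poly_mat A (pCons c p) * G k = c \<cdot>\<^sub>m G k + poly_mat A p * (A * G k)"
    using G(1)[OF pCons.prems] A
    unfolding poly_mat_pCons
    by (subst add_mult_distrib_mat[OF _ mult_carrier_mat[OF poly_mat_carrier A]])
      (simp_all add: assoc_mult_mat[OF poly_mat_carrier A] mult_smult_assoc_mat[of _ n n])
  then show ?case
    using pCons G(1)[OF pCons.prems] A G(2)[OF pCons.prems] assms(3,4)
       mult_carrier_mat[OF poly_mat_carrier[of p] mult_carrier_mat[OF A G(1)[OF pCons.prems]]]
    by (simp add: shift_act_pCons)
qed

end

lemma poly_mat_linear: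
  assumes "A \<in> carrier_mat n n"
  shows "poly_mat A [:- a, 1:] = char_matrix A a"
  using assms by (simp add: poly_mat_pCons[OF assms] poly_mat_1[OF assms] char_matrix_def
    comm_add_mat[of _ n n] flip: one_pCons)

text \<open>The elements \<open>p\<close> and \<open>q\<close> generate the unit ideal. For polynomials over a field this is coprimality, in the
  form of a Bezout identity.\<close>

definition comaximal :: "'a::comm_ring_1 \<Rightarrow> 'a \<Rightarrow> bool" where
  "comaximal p q \<longleftrightarrow> (\<exists>u v. u * p + v * q = 1)"

lemma comaximal_sym: "comaximal p q \<Longrightarrow> comaximal q p"
  unfolding comaximal_def by (metis add.commute)

lemma comaximal_1 [simp]: "comaximal p 1"
  unfolding comaximal_def by (intro exI[of _ 0] exI[of _ 1]) simp

lemma comaximal_mult: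
  assumes "comaximal p q" "comaximal p r" shows "comaximal p (q * r)"
proof -
  from assms obtain u v u' v' where *: "u * p + v * q = 1" "u' * p + v' * r = 1"
    by (auto simp: comaximal_def)
  have "(u * u' * p + u * v' * r + v * q * u') * p + (v * v') * (q * r) = (u * p + v * q) * (u' * p + v' * r)"
    by (simp add: algebra_simps)
  then show ?thesis unfolding comaximal_def * by (metis mult_1)
qed

lemma comaximal_power: "comaximal p q \<Longrightarrow> comaximal p (q ^ k)"
  by (induction k) (auto intro: comaximal_mult)

lemma comaximal_prod: "(\<And>x. x \<in> I \<Longrightarrow> comaximal p (q x)) \<Longrightarrow> comaximal p (\<Prod>x\<in>I. q x)"
  by (induction I rule: infinite_finite_induct) (auto intro: comaximal_mult)

lemma comaximal_linear:
  fixes a b :: "'a::field"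
  assumes "a \<noteq> b"
  shows "comaximal [:- a, 1:] [:- b, 1:]"
  unfolding comaximal_def
proof (intro exI)
  have "b * inverse (b - a) - a * inverse (b - a) = 1"
    using assms by (simp flip: left_diff_distrib)
  then show "[:inverse (b - a):] * [:- a, 1:] + [:- inverse (b - a):] * [:- b, 1:] = 1"
    by (simp add: one_pCons mult.commute)
qed

lemma comaximal_split_poly:
  "a \<notin> S \<Longrightarrow> comaximal ([:- a, 1:] ^ k) (split_poly S d)"
  unfolding split_poly_def
  by (intro comaximal_prod comaximal_power comaximal_sym[OF comaximal_power] comaximal_linear) auto

section \<open>Kernels and generalized eigenspaces\<close>

lemma eq_mat_if_mult_vec_eq:
  fixes A B :: "'a::semiring_1 mat"
  assumes "A \<in> carrier_mat m n" "B \<in> carrier_mat m n"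
    and eq: "\<And>v. v \<in> carrier_vec n \<Longrightarrow> A *\<^sub>v v = B *\<^sub>v v"
  shows "A = B"
proof (rule eq_matI)
  fix i j assume "i < dim_row B" "j < dim_col B"
  then have ij: "i < m" "j < n" using assms by auto
  have "(A *\<^sub>v unit_vec n j) $ i = (B *\<^sub>v unit_vec n j) $ i" by (simp add: eq)
  then show "A $$ (i, j) = B $$ (i, j)"
    using ij assms(1,2) by (simp add: scalar_prod_right_unit)
qed (use assms in auto)

lemma mult_mat_zero_vec: "A \<in> carrier_mat m n \<Longrightarrow> A *\<^sub>v 0\<^sub>v n = 0\<^sub>v m"
  for A :: "'a::semiring_0 mat"
  by (intro eq_vecI) auto

lemma comaximal_kernels:
  assumes A: "A \<in> carrier_mat n n" and v: "v \<in> carrier_vec n" and "comaximal p q"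
    and p: "poly_mat A p *\<^sub>v v = 0\<^sub>v n" and q: "poly_mat A q *\<^sub>v v = 0\<^sub>v n"
  shows "v = 0\<^sub>v n"
proof -
  note M = poly_mat_carrier[OF A]
  from assms(3) obtain s t where st: "s * p + t * q = 1" by (auto simp: comaximal_def)
  have "v = poly_mat A (s * p + t * q) *\<^sub>v v"
    using v by (simp add: st poly_mat_1[OF A])
  also have "\<dots> = poly_mat A (s * p) *\<^sub>v v + poly_mat A (t * q) *\<^sub>v v"
    unfolding poly_mat_add[OF A] add_mult_distrib_mat_vec[OF M M v] ..
  also have "\<dots> = 0\<^sub>v n"
    unfolding poly_mat_mult[OF A] assoc_mult_mat_vec[OF M M v] p q
    by (simp add: mult_mat_zero_vec[OF M])
  finally show ?thesis .
qed

text \<open>The last nonzero vector among \<open>v\<close>, \<open>(A - a) v\<close>, \<open>(A - a)\<^sup>2 v\<close>, \<open>\<dots>\<close> is an eigenvector.\<close>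

lemma eigenvalueI_gen_eigenspace:
  assumes A: "A \<in> carrier_mat n n" and v: "v \<in> carrier_vec n" "v \<noteq> 0\<^sub>v n"
    and "(char_matrix A a ^\<^sub>m k) *\<^sub>v v = 0\<^sub>v n"
  shows "eigenvalue A a"
  using assms(4)
proof (induction k)
  case 0
  then show ?case using v carrier_matD(1)[OF char_matrix_closed[OF A]] by simp
next
  case (Suc k)
  let ?C = "char_matrix A a"
  have C: "?C \<in> carrier_mat n n" using A by simp
  have "?C ^\<^sub>m Suc k = ?C * ?C ^\<^sub>m k"
    using poly_mat_mult[OF A, of "[:- a, 1:]" "[:- a, 1:] ^ k"]
    by (simp only: poly_mat_power[OF A] poly_mat_linear[OF A] flip: power_Suc)
  then have "?C *\<^sub>v (?C ^\<^sub>m k *\<^sub>v v) = 0\<^sub>v n"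
    using Suc.prems v C by (simp add: assoc_mult_mat_vec[of _ n n _ n] pow_carrier_mat)
  then show ?case
    using Suc.IH mult_mat_vec_carrier[OF pow_carrier_mat[OF C] v(1), of k]
    by (cases "?C ^\<^sub>m k *\<^sub>v v = 0\<^sub>v n") (auto simp: eigenvalue_char_matrix[OF A])
qed

lemma gen_eigenspace_iff:
  assumes A: "A \<in> carrier_mat n n"
  shows "v \<in> gen_eigenspace A a \<longleftrightarrow>
    v \<in> carrier_vec n \<and> (\<exists>k. poly_mat A ([:- a, 1:] ^ k) *\<^sub>v v = 0\<^sub>v n)"
  using mat_kernel[OF pow_carrier_mat[OF char_matrix_closed[OF A]]]
  by (auto simp: gen_eigenspace_def poly_mat_power[OF A] poly_mat_linear[OF A])

text \<open>Primary decomposition: the kernel of a product of powers of \<open>A - a\<close> with distinct \<open>a \<noteq> 0\<close> lies in the sum of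
  the generalized eigenspaces at nonzero eigenvalues. The roots \<open>a\<close> need not be eigenvalues; those that
  are not contribute the zero subspace.\<close>

lemma split_poly_kernel_subset:
  assumes A: "A \<in> carrier_mat n n" and S: "finite S" "0 \<notin> S"
    and v: "v \<in> carrier_vec n" and "poly_mat A (split_poly S d) *\<^sub>v v = 0\<^sub>v n"
  shows "v \<in> nonzero_gen_eigenspaces A"
proof -
  note M = poly_mat_carrier[OF A]
  interpret vec_space "TYPE('a)" n .
  define E where "E = (\<Union>e\<in>{e. eigenvalue A e \<and> e \<noteq> 0}. gen_eigenspace A e)"
  have E: "E \<subseteq> carrier_vec n" by (auto simp: E_def gen_eigenspace_iff[OF A])
  have nz: "nonzero_gen_eigenspaces A = span E"
    using A by (simp add: nonzero_gen_eigenspaces_def E_def)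
  have sub: "submodule class_ring (span E) V" using E by (intro span_is_submodule) simp
  have zero: "0\<^sub>v n \<in> span E" using submodule.zero_closed[OF sub] by simp
  have "v \<in> span E" using S v assms(5)
  proof (induction S arbitrary: v rule: finite_induct)
    case empty
    then show ?case using zero by (simp add: split_poly_def poly_mat_1[OF A])
  next
    case (insert a S)
    let ?q = "[:- a, 1:] ^ d" and ?h = "split_poly S d"
    have fac: "split_poly (insert a S) d = ?q * ?h"
      using insert by (simp add: split_poly_def)
    obtain s t where st: "s * ?q + t * ?h = 1"
      using comaximal_split_poly[OF insert.hyps(2), of d d] unfolding comaximal_def by blast
    let ?v1 = "poly_mat A (s * ?q) *\<^sub>v v" and ?v2 = "poly_mat A (t * ?h) *\<^sub>v v"
    have v: "v = ?v1 + ?v2"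
      using insert.prems(2) st
      by (simp add: poly_mat_1[OF A] flip: add_mult_distrib_mat_vec[OF M M] poly_mat_add[OF A])
    have kill: "poly_mat A p' *\<^sub>v (poly_mat A p *\<^sub>v v) = 0\<^sub>v n"
      if "p' * p = f * (?q * ?h)" for p p' f
    proof -
      have "poly_mat A p' *\<^sub>v (poly_mat A p *\<^sub>v v) = poly_mat A (p' * p) *\<^sub>v v"
        unfolding poly_mat_mult[OF A] assoc_mult_mat_vec[OF M M insert.prems(2)] ..
      also have "\<dots> = poly_mat A f *\<^sub>v (poly_mat A (split_poly (insert a S) d) *\<^sub>v v)"
        unfolding that fac poly_mat_mult[OF A, of f]
          assoc_mult_mat_vec[OF M M insert.prems(2)] ..
      finally show ?thesis by (simp add: insert.prems(3) mult_mat_zero_vec[OF M])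
    qed
    have "?v1 \<in> span E"
    proof (rule insert.IH)
      show "poly_mat A ?h *\<^sub>v ?v1 = 0\<^sub>v n" by (rule kill[of _ _ s]) simp
    qed (use insert.prems mult_mat_vec_carrier[OF M] in auto)
    moreover have "?v2 \<in> span E"
    proof (cases "?v2 = 0\<^sub>v n")
      case False
      have *: "poly_mat A ?q *\<^sub>v ?v2 = 0\<^sub>v n" by (rule kill[of _ _ t]) simp
      have c: "?v2 \<in> carrier_vec n" by (rule mult_mat_vec_carrier[OF M insert.prems(2)])
      then have "eigenvalue A a"
        using eigenvalueI_gen_eigenspace[OF A c False] *
        by (simp add: poly_mat_power[OF A] poly_mat_linear[OF A])
      then have "?v2 \<in> E"
        using insert.prems(1) * c by (auto simp: E_def gen_eigenspace_iff[OF A])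
      then show ?thesis using in_own_span[of E] E by auto
    qed (use zero in simp)
    ultimately have "?v1 + ?v2 \<in> span E" using submodule.m_closed[OF sub] by simp
    then show ?case using v by simp
  qed
  then show ?thesis by (simp add: nz)
qed

section \<open>The core-nilpotent decomposition\<close>

text \<open>A matrix with \<open>h(A) A\<^bsup>r+1\<^esup> = 0\<close>, where \<open>h\<close> splits with nonzero roots, together with a Bezout identity for
  \<open>h\<close> and \<open>X\<^bsup>r+1\<^esup>\<close>. All matrices of interest are polynomials in \<open>A\<close>, so identities between them are checked
  as divisibilities by the annihilating polynomial \<open>m\<close>. The exponent is positive in order that \<open>drazin_poly\<close>,
  where one factor \<open>X\<close> is cancelled, makes sense.\<close>

locale core_nilpotent =
  fixes n :: nat and A :: "'a::field mat" and S :: "'a set" and d r :: nat and u w :: "'a poly"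
  assumes A: "A \<in> carrier_mat n n"
    and S: "finite S" "0 \<notin> S"
    and ann: "poly_mat A (split_poly S d * [:0, 1:] ^ Suc r) = 0\<^sub>m n n"
    and bezout: "u * [:0, 1:] ^ Suc r + w * split_poly S d = 1"
begin

abbreviation h where "h \<equiv> split_poly S d"
abbreviation m where "m \<equiv> h * [:0, 1:] ^ Suc r"

text \<open>At \<open>A\<close>, these two polynomials give the complementary projections onto the generalized eigenspace at \<open>0\<close>
  and onto the sum of the other generalized eigenspaces.\<close>

definition nil_poly :: "'a poly" where "nil_poly = w * h"
definition core_poly :: "'a poly" where "core_poly = u * [:0, 1:] ^ Suc r"

text \<open>Since \<open>u X\<^bsup>r+1\<^esup>\<close> is the identity on the core, \<open>u X\<^sup>r\<close> inverts \<open>A\<close> there; the factor \<open>core_poly\<close> makes it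
  vanish on the nilpotent part.\<close>

definition drazin_poly :: "'a poly" where "drazin_poly = u * [:0, 1:] ^ r * core_poly"

lemmas M = poly_mat_carrier[OF A]
lemmas M_cong = poly_mat_cong[OF A ann]
lemmas M_eq_0 = poly_mat_eq_0[OF A ann]
lemmas M_mult = poly_mat_mult[OF A, symmetric]

lemma core_add_nil: "core_poly + nil_poly = 1"
  using bezout by (simp only: core_poly_def nil_poly_def)

lemma nil_eq: "nil_poly = 1 - core_poly"
  using core_add_nil by (simp add: eq_diff_eq add.commute)

lemma dvd_nil_core: "m dvd nil_poly * core_poly"
proof -
  have "nil_poly * core_poly = m * (w * u)" by (simp only: nil_poly_def core_poly_def mult_ac)
  then show ?thesis by (simp only: dvd_triv_left)
qed

lemma dvd_nil_X: "m dvd [:0, 1:] ^ Suc r * nil_poly"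
proof -
  have "[:0, 1:] ^ Suc r * nil_poly = m * w" by (simp only: nil_poly_def mult_ac)
  then show ?thesis by (simp only: dvd_triv_left)
qed

lemma dvd_h_core: "m dvd h * core_poly"
proof -
  have "h * core_poly = m * u" by (simp only: core_poly_def mult_ac)
  then show ?thesis by (simp only: dvd_triv_left)
qed

lemma dvd_h_drazin: "m dvd h * drazin_poly"
  using dvd_mult[OF dvd_h_core, of "u * [:0, 1:] ^ r"] by (simp only: drazin_poly_def mult_ac)

lemma dvd_nil_drazin: "m dvd nil_poly * drazin_poly"
  using dvd_mult[OF dvd_nil_core, of "u * [:0, 1:] ^ r"] by (simp only: drazin_poly_def mult_ac)

lemma X_drazin: "[:0, 1:] * drazin_poly = core_poly * core_poly"
  by (simp only: drazin_poly_def core_poly_def power_Suc mult_ac)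

lemma dvd_core_sub: "m dvd core_poly - [:0, 1:] * drazin_poly"
proof -
  have "core_poly - [:0, 1:] * drazin_poly = nil_poly * core_poly"
    by (simp only: X_drazin nil_eq left_diff_distrib mult_1)
  then show ?thesis using dvd_nil_core by simp
qed

lemma dvd_drazin_sub: "m dvd drazin_poly - core_poly * drazin_poly"
proof -
  have "drazin_poly - core_poly * drazin_poly = nil_poly * drazin_poly"
    by (simp only: nil_eq left_diff_distrib mult_1)
  then show ?thesis using dvd_nil_drazin by simp
qed

lemma dvd_core_sub_power: "m dvd core_poly - [:0, 1:] ^ Suc k * drazin_poly ^ Suc k"
proof (induction k)
  case 0
  then show ?case using dvd_core_sub by simp
next
  case (Suc k)
  have "core_poly - [:0, 1:] ^ Suc (Suc k) * drazin_poly ^ Suc (Suc k)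
      = (core_poly - [:0, 1:] * drazin_poly)
        + [:0, 1:] * (drazin_poly - core_poly * drazin_poly)
        + [:0, 1:] * drazin_poly * (core_poly - [:0, 1:] ^ Suc k * drazin_poly ^ Suc k)"
    unfolding power_Suc[of _ "Suc k"] by (simp only: algebra_simps) 
  then show ?case
    using Suc dvd_core_sub dvd_drazin_sub by (simp only: dvd_add dvd_mult)
qed

text \<open>The two-sided orbit \<open>(1 - \<pi>\<^sub>0) A\<^sup>k\<close> for \<open>k \<ge> 0\<close> and \<open>A\<^sub>d\<^bsup>-k\<^esup>\<close> for \<open>k < 0\<close>, as polynomials in \<open>A\<close>.\<close>

definition orbit_poly :: "int \<Rightarrow> 'a poly" where
  "orbit_poly k = (if k \<ge> 0 then core_poly * [:0, 1:] ^ nat k else drazin_poly ^ nat (- k))"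

lemma dvd_orbit_poly_step: "m dvd orbit_poly (k + 1) - [:0, 1:] * orbit_poly k"
proof -
  consider "k \<ge> 0" | "k = -1" | "k < -1" by linarith
  then show ?thesis
  proof cases
    case 1
    then show ?thesis by (simp add: orbit_poly_def nat_add_distrib mult_ac)
  next
    case 2
    then show ?thesis using dvd_core_sub by (simp add: orbit_poly_def)
  next
    case 3
    define j where "j = nat (- k - 2)"
    have k: "nat (- k) = Suc (Suc j)" "nat (- (k + 1)) = Suc j"
      using 3 by (simp_all add: j_def)
    have "orbit_poly (k + 1) - [:0, 1:] * orbit_poly k
        = drazin_poly ^ j * ((drazin_poly - core_poly * drazin_poly)
            + drazin_poly * (core_poly - [:0, 1:] * drazin_poly))"
      using 3 unfolding orbit_poly_def k power_Suc by (simp only: algebra_simps) simp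
    then show ?thesis
      using dvd_core_sub dvd_drazin_sub by (simp only: dvd_add dvd_mult)
  qed
qed

lemma orbit_step: "poly_mat A (orbit_poly (k + 1)) = A * poly_mat A (orbit_poly k)"
  using M_cong[OF dvd_orbit_poly_step] by (simp only: poly_mat_mult[OF A] poly_mat_X[OF A])

lemma h_orbit: "poly_mat A h * poly_mat A (orbit_poly k) = 0\<^sub>m n n"
proof -
  have "m dvd h * orbit_poly k"
  proof (cases "k \<ge> 0")
    case True
    then show ?thesis
      using dvd_mult[OF dvd_h_core, of "[:0, 1:] ^ nat k"] by (simp add: orbit_poly_def mult_ac)
  next
    case False
    then obtain j where "nat (- k) = Suc j" by (cases "nat (- k)") auto
    then show ?thesis
      using False dvd_mult[OF dvd_h_drazin, of "drazin_poly ^ j"]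
      by (simp only: orbit_poly_def power_Suc mult_ac if_False)
  qed
  then show ?thesis unfolding M_mult by (rule M_eq_0)
qed

lemma orbit_eq_power: "k \<ge> Suc r \<Longrightarrow> poly_mat A (orbit_poly (int k)) = A ^\<^sub>m k"
proof -
  assume "k \<ge> Suc r"
  then have k: "[:0, 1:] ^ k = [:0, 1:] ^ Suc r * [:0, 1:] ^ (k - Suc r)"
    by (simp only: le_add_diff_inverse flip: power_add)
  have "m dvd [:0, 1:] ^ k - core_poly * [:0, 1:] ^ k"
  proof -
    have "[:0, 1:] ^ k - core_poly * [:0, 1:] ^ k
        = [:0, 1:] ^ (k - Suc r) * ([:0, 1:] ^ Suc r * nil_poly)"
      unfolding k nil_eq by (simp only: algebra_simps mult_1)
    then show ?thesis using dvd_nil_X by (simp only: dvd_mult)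
  qed
  then show ?thesis by (simp add: M_cong orbit_poly_def flip: poly_mat_X_power[OF A])
qed

lemma is_drazin:
  "A ^\<^sub>m Suc r * poly_mat A drazin_poly * A = A ^\<^sub>m Suc r"
  "A * poly_mat A drazin_poly = poly_mat A drazin_poly * A"
  "poly_mat A drazin_poly * A * poly_mat A drazin_poly = poly_mat A drazin_poly"
proof -
  have MA: "poly_mat A [:0, 1:] = A" and MX: "poly_mat A ([:0, 1:] ^ Suc r) = A ^\<^sub>m Suc r"
    by (rule poly_mat_X[OF A], rule poly_mat_X_power[OF A])
  have "[:0, 1:] ^ Suc r - [:0, 1:] ^ Suc r * drazin_poly * [:0, 1:]
      = [:0, 1:] ^ Suc r * nil_poly + [:0, 1:] ^ Suc r * (core_poly - [:0, 1:] * drazin_poly)"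
    unfolding nil_eq by (simp only: algebra_simps mult_1)
  then have "m dvd [:0, 1:] ^ Suc r - [:0, 1:] ^ Suc r * drazin_poly * [:0, 1:]"
    using dvd_nil_X dvd_core_sub by (simp only: dvd_add dvd_mult)
  from M_cong[OF this] show "A ^\<^sub>m Suc r * poly_mat A drazin_poly * A = A ^\<^sub>m Suc r"
    by (simp only: poly_mat_mult[OF A] MA MX)
  show "A * poly_mat A drazin_poly = poly_mat A drazin_poly * A"
    using poly_mat_mult[OF A, of "[:0, 1:]" drazin_poly] poly_mat_mult[OF A, of drazin_poly "[:0, 1:]"]
    by (simp only: MA mult.commute)
  have "drazin_poly - drazin_poly * [:0, 1:] * drazin_poly
      = (drazin_poly - core_poly * drazin_poly) + drazin_poly * (core_poly - [:0, 1:] * drazin_poly)"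
    by (simp only: algebra_simps)
  then have "m dvd drazin_poly - drazin_poly * [:0, 1:] * drazin_poly"
    using dvd_drazin_sub dvd_core_sub by (simp only: dvd_add dvd_mult)
  from M_cong[OF this] show "poly_mat A drazin_poly * A * poly_mat A drazin_poly = poly_mat A drazin_poly"
    by (simp only: poly_mat_mult[OF A] MA)
qed

text \<open>Write \<open>G\<close> and \<open>P\<close> for the core and nilpotent projections and \<open>D\<close> for the value of \<open>drazin_poly\<close>. As \<open>B\<close> is divisible by
  every power of \<open>A\<close>, it satisfies \<open>P B = 0\<close>, so \<open>G B = B\<close>; and \<open>A B\<close> fixes the range of \<open>G\<close>, because \<open>G\<close>
  is a multiple of \<open>A\<^bsup>k+1\<^esup>\<close>. Hence \<open>D = G D = A B G D = A B D = B G = B\<close>.\<close>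

lemma drazin_unique:
  assumes B: "B \<in> carrier_mat n n" and BAB: "B * A * B = B" and AB: "A * B = B * A"
    and k: "A ^\<^sub>m k * B * A = A ^\<^sub>m k"
  shows "B = poly_mat A drazin_poly"
proof -
  let ?G = "poly_mat A core_poly" and ?P = "poly_mat A nil_poly" and ?D = "poly_mat A drazin_poly"
  note assoc = assoc_mult_mat[of _ n n _ n _ n]
  have comm: "poly_mat A p * B = B * poly_mat A p" for p
    by (rule poly_mat_commute[OF A B AB])
  have [simp]: "A ^\<^sub>m j \<in> carrier_mat n n" for j using A by (rule pow_carrier_mat)
  have Ap: "A ^\<^sub>m j * A = A * A ^\<^sub>m j" for j
    using poly_mat_mult[OF A, of "[:0, 1:] ^ j" "[:0, 1:]"] poly_mat_mult[OF A, of "[:0, 1:]" "[:0, 1:] ^ j"]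
    by (simp only: poly_mat_X_power[OF A] poly_mat_X[OF A] mult.commute)
  have Bp: "A ^\<^sub>m j * B = B * A ^\<^sub>m j" for j
    using comm[of "[:0, 1:] ^ j"] by (simp only: poly_mat_X_power[OF A])
  have "\<exists>C\<in>carrier_mat n n. B = A ^\<^sub>m j * C" for j
  proof (induction j)
    case 0
    then show ?case using A B by (intro bexI[of _ B]) auto
  next
    case (Suc j)
    then obtain C where C: "C \<in> carrier_mat n n" "B = A ^\<^sub>m j * C" by blast
    have "B = A * B * B" using BAB AB by simp
    also have "\<dots> = A * (B * (A ^\<^sub>m j * C))" using A B by (simp only: assoc flip: C(2))
    also have "\<dots> = A * (A ^\<^sub>m j * B * C)" using A B C(1) by (simp add: Bp assoc)
    also have "\<dots> = A ^\<^sub>m Suc j * (B * C)" using A B C(1) by (simp add: Ap assoc)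
    finally show ?case using B C by (intro bexI[of _ "B * C"]) auto
  qed
  then obtain C where C: "C \<in> carrier_mat n n" "B = A ^\<^sub>m Suc r * C" by blast
  have "?P * B = ?P * A ^\<^sub>m Suc r * C"
    using C(1) M[of nil_poly] by (simp only: C(2) assoc_mult_mat[of ?P n n "A ^\<^sub>m Suc r" n C n] \<open>\<And>j. A ^\<^sub>m j \<in> carrier_mat n n\<close>)
  also have "\<dots> = poly_mat A ([:0, 1:] ^ Suc r * nil_poly) * C"
    by (simp only: mult.commute[of "[:0, 1:] ^ Suc r"] poly_mat_mult[OF A, of nil_poly] poly_mat_X_power[OF A])
  finally have PB: "?P * B = 0\<^sub>m n n" using C(1) by (simp only: M_eq_0[OF dvd_nil_X] left_mult_zero_mat)
  have GB: "?G * B = B"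
  proof -
    have "B = poly_mat A (core_poly + nil_poly) * B"
      using B by (simp add: core_add_nil poly_mat_1[OF A])
    also have "\<dots> = ?G * B + ?P * B"
      by (simp only: poly_mat_add[OF A] add_mult_distrib_mat[OF M M B])
    also have "\<dots> = ?G * B"
      unfolding PB by (rule right_add_zero_mat[OF mult_carrier_mat[OF M B]])
    finally show ?thesis ..
  qed
  have GAD: "A * ?D = ?G"
    using M_cong[OF dvd_core_sub] by (simp only: poly_mat_mult[OF A] poly_mat_X[OF A])
  have GD: "?G * ?D = ?D"
    using M_cong[OF dvd_drazin_sub] by (simp only: poly_mat_mult[OF A])
  let ?E = "poly_mat A (drazin_poly ^ Suc k)"
  have G: "?G = A ^\<^sub>m Suc k * ?E"
    using M_cong[OF dvd_core_sub_power] by (simp only: poly_mat_mult[OF A] poly_mat_X_power[OF A])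
  have "A * B * A ^\<^sub>m Suc k = A * (A ^\<^sub>m k * B * A)"
    using A B by (simp add: assoc Bp mult_carrier_mat[of _ n n _ n])
  also have "\<dots> = A ^\<^sub>m Suc k" by (simp add: k Ap)
  finally have ABG: "A * B * ?G = ?G"
    using A B M[of "drazin_poly ^ Suc k"] unfolding G
    by (simp only: assoc_mult_mat[of "A * B" n n "A ^\<^sub>m Suc k" n ?E n, symmetric]
        mult_carrier_mat pow_carrier_mat)
  have "?D = A * B * ?G * ?D" by (simp only: ABG GD)
  also have "\<dots> = A * B * ?D" using A B M by (simp add: assoc GD)
  also have "\<dots> = B * ?G" using A B M by (simp add: AB assoc GAD)
  also have "\<dots> = B" by (simp only: GB flip: comm)
  finally show ?thesis ..
qed

lemma drazin_inverse_eq: "drazin_inverse A = poly_mat A drazin_poly"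
  unfolding drazin_inverse_def
proof (rule the_equality)
  show "poly_mat A drazin_poly \<in> carrier_mat (dim_row A) (dim_row A) \<and>
    (\<exists>k. A ^\<^sub>m k * poly_mat A drazin_poly * A = A ^\<^sub>m k) \<and>
    A * poly_mat A drazin_poly = poly_mat A drazin_poly * A \<and>
    poly_mat A drazin_poly * A * poly_mat A drazin_poly = poly_mat A drazin_poly"
    using A M is_drazin by blast
  show "B = poly_mat A drazin_poly"
    if "B \<in> carrier_mat (dim_row A) (dim_row A) \<and> (\<exists>k. A ^\<^sub>m k * B * A = A ^\<^sub>m k) \<and>
      A * B = B * A \<and> B * A * B = B" for B
    using that A drazin_unique by auto
qed

lemma poly_mat_0_vec:
  "m dvd p \<Longrightarrow> v \<in> carrier_vec n \<Longrightarrow> poly_mat A p *\<^sub>v v = 0\<^sub>v n"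
  unfolding M_eq_0 by (intro eq_vecI) auto

lemma mult_vec: "v \<in> carrier_vec n \<Longrightarrow> poly_mat A p *\<^sub>v (poly_mat A q *\<^sub>v v) = poly_mat A (p * q) *\<^sub>v v"
  by (simp add: poly_mat_mult[OF A] assoc_mult_mat_vec[OF M M])

lemma core_add_nil_vec:
  assumes v: "v \<in> carrier_vec n"
  shows "poly_mat A nil_poly *\<^sub>v v + poly_mat A core_poly *\<^sub>v v = v"
proof -
  have "poly_mat A (nil_poly + core_poly) *\<^sub>v v = v"
    using v by (simp add: core_add_nil add.commute poly_mat_1[OF A])
  then show ?thesis by (simp only: poly_mat_add[OF A] add_mult_distrib_mat_vec[OF M M v])
qed

text \<open>The vector \<open>s(A) v\<close> is killed by both \<open>p(A)\<close> and \<open>q(A)\<close>.\<close>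

lemma eq_0_vec_if_comaximal:
  assumes v: "v \<in> carrier_vec n" and "comaximal p q"
    and p: "poly_mat A p *\<^sub>v v = 0\<^sub>v n" and q: "m dvd q * s"
  shows "poly_mat A s *\<^sub>v v = 0\<^sub>v n"
proof (rule comaximal_kernels[OF A _ assms(2)])
  show "poly_mat A s *\<^sub>v v \<in> carrier_vec n" by (rule mult_mat_vec_carrier[OF M v])
  have "poly_mat A p *\<^sub>v (poly_mat A s *\<^sub>v v) = poly_mat A s *\<^sub>v (poly_mat A p *\<^sub>v v)"
    using v by (simp only: mult_vec mult.commute)
  then show "poly_mat A p *\<^sub>v (poly_mat A s *\<^sub>v v) = 0\<^sub>v n" using p by (simp add: mult_mat_zero_vec[OF M])
  show "poly_mat A q *\<^sub>v (poly_mat A s *\<^sub>v v) = 0\<^sub>v n"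
    using v by (simp only: mult_vec poly_mat_0_vec[OF q])
qed

lemma nil_mult_gen_eigenspace_0:
  assumes "x \<in> gen_eigenspace A 0"
  shows "poly_mat A nil_poly *\<^sub>v x = x"
proof -
  obtain k where x: "x \<in> carrier_vec n" and k: "poly_mat A ([:- 0, 1:] ^ k) *\<^sub>v x = 0\<^sub>v n"
    using assms by (auto simp: gen_eigenspace_iff[OF A])
  have "poly_mat A core_poly *\<^sub>v x = 0\<^sub>v n"
    by (rule eq_0_vec_if_comaximal[OF x comaximal_split_poly[OF S(2)] k dvd_h_core])
  then show ?thesis using core_add_nil_vec[OF x] x M[of nil_poly] by simp
qed

lemma nil_mult_nonzero_gen_eigenspaces:
  assumes "y \<in> nonzero_gen_eigenspaces A"
  shows "poly_mat A nil_poly *\<^sub>v y = 0\<^sub>v n" and "y \<in> carrier_vec n"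
proof -
  interpret vec_space "TYPE('a)" n .
  let ?N = "mat_kernel (poly_mat A nil_poly)"
  let ?E = "\<Union>e\<in>{e. eigenvalue A e \<and> e \<noteq> 0}. gen_eigenspace A e"
  have "?E \<subseteq> ?N"
  proof
    fix y assume "y \<in> ?E"
    then obtain e k where e: "e \<noteq> 0" and y: "y \<in> carrier_vec n"
      and k: "poly_mat A ([:- e, 1:] ^ k) *\<^sub>v y = 0\<^sub>v n"
      by (auto simp: gen_eigenspace_iff[OF A])
    have "comaximal ([:- e, 1:] ^ k) ([:- 0, 1:] ^ Suc r)"
      by (intro comaximal_power comaximal_sym[OF comaximal_power] comaximal_linear) (use e in simp)
    from eq_0_vec_if_comaximal[OF y this k] dvd_nil_X show "y \<in> ?N"
      using y by (intro mat_kernelI[OF M]) simp_all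
  qed
  moreover have "submodule class_ring ?N V"
  proof
    show "?N \<subseteq> carrier V" using mat_kernel_carrier[OF M] by simp
    show "v \<oplus>\<^bsub>V\<^esub> v' \<in> ?N" if "v \<in> ?N" "v' \<in> ?N" for v v'
      using mat_kernelD[OF M that(1)] mat_kernelD[OF M that(2)]
      by (intro mat_kernelI[OF M]) (simp_all add: mult_add_distrib_mat_vec[OF M])
    show "\<zero>\<^bsub>V\<^esub> \<in> ?N" by (intro mat_kernelI[OF M]) (simp_all add: mult_mat_zero_vec[OF M])
    show "c \<odot>\<^bsub>V\<^esub> v \<in> ?N" if "v \<in> ?N" for c v
      using mat_kernel_smult[OF M that] by simp
  qed
  ultimately have "nonzero_gen_eigenspaces A \<subseteq> ?N"
    using A span_is_subset by (simp add: nonzero_gen_eigenspaces_def)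
  with assms mat_kernelD[OF M] show "poly_mat A nil_poly *\<^sub>v y = 0\<^sub>v n" "y \<in> carrier_vec n"
    by blast+
qed

lemma spectral_projection_0_eq: "spectral_projection_0 A = poly_mat A nil_poly"
  unfolding spectral_projection_0_def
proof (rule the_equality)
  have "poly_mat A nil_poly *\<^sub>v (x + y) = x"
    if "x \<in> gen_eigenspace A 0" "y \<in> nonzero_gen_eigenspaces A" for x y
  proof -
    have x: "x \<in> carrier_vec n" using that(1) by (simp add: gen_eigenspace_iff[OF A])
    show ?thesis
      using x nil_mult_nonzero_gen_eigenspaces[OF that(2)] nil_mult_gen_eigenspace_0[OF that(1)]
      by (simp add: mult_add_distrib_mat_vec[OF M])
  qed
  then show "poly_mat A nil_poly \<in> carrier_mat (dim_row A) (dim_row A) \<and>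
      (\<forall>x\<in>gen_eigenspace A 0. \<forall>y\<in>nonzero_gen_eigenspaces A. poly_mat A nil_poly *\<^sub>v (x + y) = x)"
    using A by simp
next
  fix P assume "P \<in> carrier_mat (dim_row A) (dim_row A) \<and>
      (\<forall>x\<in>gen_eigenspace A 0. \<forall>y\<in>nonzero_gen_eigenspaces A. P *\<^sub>v (x + y) = x)"
  then have P: "P \<in> carrier_mat n n"
    and proj: "\<And>x y. x \<in> gen_eigenspace A 0 \<Longrightarrow> y \<in> nonzero_gen_eigenspaces A \<Longrightarrow> P *\<^sub>v (x + y) = x"
    using A by auto
  show "P = poly_mat A nil_poly"
  proof (rule eq_mat_if_mult_vec_eq[OF P M])
    fix v :: "'a vec" assume v: "v \<in> carrier_vec n"
    let ?x = "poly_mat A nil_poly *\<^sub>v v" and ?y = "poly_mat A core_poly *\<^sub>v v"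
    have "poly_mat A ([:- 0, 1:] ^ Suc r) *\<^sub>v ?x = 0\<^sub>v n"
      using v poly_mat_0_vec[OF dvd_nil_X] by (simp only: mult_vec minus_zero)
    then have "?x \<in> gen_eigenspace A 0"
      using mult_mat_vec_carrier[OF M v] unfolding gen_eigenspace_iff[OF A] by blast
    moreover have "?y \<in> nonzero_gen_eigenspaces A"
    proof (rule split_poly_kernel_subset[OF A S])
      show "poly_mat A h *\<^sub>v ?y = 0\<^sub>v n" using v by (simp only: mult_vec poly_mat_0_vec[OF dvd_h_core])
    qed (rule mult_mat_vec_carrier[OF M v])
    ultimately have "P *\<^sub>v (?x + ?y) = ?x" by (rule proj)
    then show "P *\<^sub>v v = ?x" by (simp only: core_add_nil_vec[OF v])
  qed
qed

text \<open>At \<open>k = 0\<close> the orbit is \<open>1 - \<pi>\<^sub>0\<close> while \<open>A\<^sub>d\<^sup>0 = 1\<close>, which accounts for the correction term.\<close>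

lemma orbit_nonpos:
  "poly_mat A (orbit_poly (- int k))
    = drazin_inverse A ^\<^sub>m k - zero_seq 0 k \<cdot>\<^sub>m spectral_projection_0 A"
proof (cases k)
  case 0
  have "1\<^sub>m n = poly_mat A core_poly + poly_mat A nil_poly"
    by (simp only: core_add_nil poly_mat_1[OF A] flip: poly_mat_add[OF A])
  then have "poly_mat A core_poly = 1\<^sub>m n - poly_mat A nil_poly"
    using M[of core_poly] M[of nil_poly] by (intro eq_matI) auto
  moreover have "1 \<cdot>\<^sub>m poly_mat A nil_poly = poly_mat A nil_poly" by auto
  ultimately show ?thesis
    using 0 A by (simp add: orbit_poly_def zero_seq_def drazin_inverse_eq spectral_projection_0_eq)
next
  case (Suc j)
  have D: "poly_mat A drazin_poly ^\<^sub>m k \<in> carrier_mat n n" by (rule pow_carrier_mat[OF M])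
  have "\<not> - int k \<ge> 0" using Suc by simp
  then have "poly_mat A (orbit_poly (- int k)) = poly_mat A drazin_poly ^\<^sub>m k"
    by (simp only: orbit_poly_def if_False minus_minus nat_int poly_mat_power[OF A])
  also have "\<dots> = poly_mat A drazin_poly ^\<^sub>m k - 0 \<cdot>\<^sub>m poly_mat A nil_poly"
    using D M[of nil_poly] by (intro eq_matI) auto
  finally show ?thesis
    using Suc by (simp add: zero_seq_def drazin_inverse_eq spectral_projection_0_eq)
qed

end

text \<open>A solution of \<open>G(k + 1) = A G(k)\<close> over all integers that is annihilated by \<open>h\<close>, agrees with the powers of
  \<open>A\<close> for large \<open>k\<close>, and consists of powers of the Drazin inverse on the negative side.\<close>

lemma drazin_orbit:
  fixes A :: "'a::field mat"
  assumes A: "A \<in> carrier_mat n n" and S: "finite S" "0 \<notin> S"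
    and ann: "poly_mat A (split_poly S d) * A ^\<^sub>m r = 0\<^sub>m n n"
  obtains G :: "int \<Rightarrow> 'a mat" where "\<And>k. G k \<in> carrier_mat n n"
    and "\<And>k. G (k + 1) = A * G k" and "\<And>k. poly_mat A (split_poly S d) * G k = 0\<^sub>m n n"
    and "\<And>k. k > r \<Longrightarrow> G (int k) = A ^\<^sub>m k"
    and "\<And>k. G (- int k) = drazin_inverse A ^\<^sub>m k - zero_seq 0 k \<cdot>\<^sub>m spectral_projection_0 A"
proof -
  obtain u w where uw: "u * [:0, 1:] ^ Suc r + w * split_poly S d = 1"
    using comaximal_split_poly[OF S(2), of "Suc r" d] unfolding comaximal_def by auto
  have "split_poly S d * [:0, 1:] ^ Suc r = split_poly S d * [:0, 1:] ^ r * [:0, 1:]"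
    by (simp only: power_Suc2 mult.assoc)
  then have "poly_mat A (split_poly S d * [:0, 1:] ^ Suc r) = 0\<^sub>m n n"
    using A by (simp only: poly_mat_mult[OF A] poly_mat_X_power[OF A] poly_mat_X[OF A] ann
        left_mult_zero_mat)
  then interpret core_nilpotent n A S d r u w
    using A S uw by unfold_locales
  show ?thesis
    by (rule that[of "\<lambda>k. poly_mat A (orbit_poly k)"])
      (use M orbit_step h_orbit orbit_eq_power orbit_nonpos in auto)
qed

section \<open>Exponential sequences and the maps replacing k by -k\<close>

lemma seq_sum_scale_apply: "(\<Sum>x\<in>I. seq_scale (c x) (g x)) k = (\<Sum>x\<in>I. c x * g x k)"
  by (induction I rule: infinite_finite_induct) (simp_all add: seq_scale_def)

lemma span_image_obtain:
  assumes "f \<in> seq.span (g ` X)"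
  obtains S c where "finite S" "S \<subseteq> X" "f = (\<lambda>k. \<Sum>x\<in>S. c x * g x k)"
proof -
  from assms obtain t r where t: "finite t" "t \<subseteq> g ` X" and f: "f = (\<Sum>s\<in>t. seq_scale (r s) s)"
    unfolding seq.span_explicit by blast
  obtain S where S: "S \<subseteq> X" "t = g ` S" "inj_on g S"
    using t(2) unfolding subset_image_inj by blast
  then have "finite S" using t(1) by (simp add: finite_image_iff)
  have "f = (\<Sum>x\<in>S. seq_scale (r (g x)) (g x))"
    unfolding f S(2) using S(3) by (simp add: sum.reindex)
  then have "f = (\<lambda>k. \<Sum>x\<in>S. r (g x) * g x k)"
    by (auto simp: seq_sum_scale_apply fun_eq_iff)
  with \<open>finite S\<close> S(1) show thesis by (rule that)
qed

lemma Sstar_image: "Sstar = geom_seq ` {a. a \<noteq> 0}"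
  by (auto simp: Sstar_def)

lemma FSstar_obtain:
  assumes "f \<in> FSstar"
  obtains S c where "finite S" "0 \<notin> S" "f = (\<lambda>k. \<Sum>a\<in>S. c a * a ^ k)"
proof -
  have "f \<in> seq.span (geom_seq ` {a. a \<noteq> 0})"
    using assms by (simp only: FSstar_def Sstar_image)
  then obtain S c where "finite S" "S \<subseteq> {a. a \<noteq> 0}" "f = (\<lambda>k. \<Sum>a\<in>S. c a * geom_seq a k)"
    by (rule span_image_obtain)
  then show thesis by (intro that[of S c]) (auto simp: geom_seq_def)
qed

lemma const_in_FSstar: "(\<lambda>k. c) \<in> FSstar"
proof -
  have "seq_scale c (geom_seq 1) \<in> FSstar"
    unfolding FSstar_def by (intro seq.span_scale seq.span_base) (auto simp: Sstar_def)
  then show ?thesis by (simp add: seq_scale_def geom_seq_def)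
qed

lemma FScirc_eventually_0:
  assumes "f \<in> FScirc" shows "eventually (\<lambda>k. f k = 0) sequentially"
proof -
  obtain I c where I: "finite I" "f = (\<lambda>k. \<Sum>i\<in>I. c i * zero_seq i k)"
    using assms unfolding FScirc_def Scirc_def by (rule span_image_obtain)
  have "f k = 0" if "k > Max I" for k
    unfolding I(2)
  proof (intro sum.neutral ballI)
    fix i assume "i \<in> I"
    then have "i < k" using Max_ge[OF I(1), of i] that by linarith
    then show "c i * zero_seq i k = 0" by (simp add: zero_seq_def)
  qed
  then show ?thesis by (auto simp: eventually_sequentially intro!: exI[of _ "Suc (Max I)"])
qed

lemma independent_Sstar: "seq.independent (Sstar :: (nat \<Rightarrow> 'a::field_char_0) set)"
  unfolding seq.independent_explicit_module
proof (intro allI impI)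
  fix t :: "(nat \<Rightarrow> 'a) set" and u v
  assume t: "finite t" "t \<subseteq> Sstar" and sum: "(\<Sum>s\<in>t. seq_scale (u s) s) = 0" and v: "v \<in> t"
  obtain S where S: "S \<subseteq> {a. a \<noteq> 0}" "t = geom_seq ` S" "inj_on geom_seq S"
    using t(2) unfolding Sstar_image subset_image_inj by blast
  then have "finite S" using t(1) by (simp add: finite_image_iff)
  have zero: "(\<Sum>a\<in>S. u (geom_seq a) * a ^ k) = 0" for k
  proof -
    have "(\<Sum>a\<in>S. u (geom_seq a) * a ^ k) = (\<Sum>s\<in>t. seq_scale (u s) s) k"
      by (simp only: S(2) sum.reindex[OF S(3)] seq_sum_scale_apply o_def) (simp add: geom_seq_def)
    then show ?thesis by (simp add: sum)
  qed
  from v S obtain b where b: "b \<in> S" "v = geom_seq b" by auto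
  have "u (geom_seq b) = 0"
  proof (rule geom_binom_independent[of S "{0}" "\<lambda>a j. u (geom_seq a)" b 0])
    show "(\<Sum>a\<in>S. \<Sum>j\<in>{0}. u (geom_seq a) * geom_binom a j n) = 0" if "n \<ge> 0" for n
      using zero[of "nat n"] that by (simp add: geom_binom_def power_int_def)
  qed (use S \<open>finite S\<close> b in auto)
  then show "u v = 0" by (simp add: b)
qed

lemma theta_sum:
  fixes S :: "'a::field_char_0 set"
  assumes "finite S" "0 \<notin> S"
  shows "theta (\<lambda>k. \<Sum>a\<in>S. c a * a ^ k) = (\<lambda>k. \<Sum>a\<in>S. c a * inverse a ^ k)"
proof -
  interpret theta: Vector_Spaces.linear seq_scale seq_scale "theta :: (nat \<Rightarrow> 'a) \<Rightarrow> _"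
    unfolding theta_def by (rule seq_pair.linear_construct[OF independent_Sstar])
  have base: "theta (geom_seq a) = (\<lambda>k. inverse a ^ k)" if "a \<in> S" for a
    unfolding theta_def using that assms
    by (subst seq_pair.construct_basis[OF independent_Sstar])
      (auto simp: Sstar_def geom_seq_def power_inverse)
  have "(\<lambda>k. \<Sum>a\<in>S. c a * a ^ k) = (\<Sum>a\<in>S. seq_scale (c a) (geom_seq a))"
    by (simp only: fun_eq_iff seq_sum_scale_apply geom_seq_def) simp
  then have "theta (\<lambda>k. \<Sum>a\<in>S. c a * a ^ k) = (\<Sum>a\<in>S. seq_scale (c a) (\<lambda>k. inverse a ^ k))"
    by (simp add: theta.sum theta.scale base)
  then show ?thesis by (simp only: fun_eq_iff seq_sum_scale_apply) simp
qed

lemma theta_const: "theta (\<lambda>k. c :: 'a::field_char_0) = (\<lambda>k. c)"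
  using theta_sum[of "{1}" "\<lambda>_. c"] by simp

text \<open>A sequence in \<open>FSstar\<close> extends to the integers by means of integer powers; on the negative side the extension
  is given by \<open>theta\<close>, and multiplying it by a binomial polynomial yields a recurrent sequence.\<close>

lemma FSstar_extension:
  assumes "f \<in> FSstar"
  shows "\<exists>g. (\<forall>k. g (int k) = f k) \<and> (\<forall>k. g (- int k) = theta f k) \<and>
    (\<forall>j. linrec (\<lambda>n. g n * (of_int n gchoose j)))"
proof -
  obtain S c where S: "finite S" "0 \<notin> S" and f: "f = (\<lambda>k. \<Sum>a\<in>S. c a * a ^ k)"
    using FSstar_obtain[OF assms] .
  let ?g = "\<lambda>n. \<Sum>a\<in>S. c a * a powi n"
  have "linrec (\<lambda>n. ?g n * (of_int n gchoose j))" for j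
  proof -
    have "linrec (\<lambda>n. \<Sum>a\<in>S. c a * geom_binom a j n)"
      using S by (intro linrec_lincomb linrec_geom_binom) auto
    then show ?thesis by (simp add: geom_binom_def sum_distrib_right mult.assoc)
  qed
  moreover have "?g (- int k) = theta f k" for k
    unfolding f theta_sum[OF S] by (simp add: power_int_minus power_inverse)
  ultimately show ?thesis by (intro exI[of _ ?g]) (auto simp: f)
qed

lemma module_independent_Lam: "module_independent FSstar (Lam :: nat \<Rightarrow> nat \<Rightarrow> 'a::field_char_0)"
  unfolding module_independent_def
proof (intro allI impI ballI, elim conjE)
  fix I and w :: "nat \<Rightarrow> nat \<Rightarrow> 'a" and i
  assume I: "finite I" "\<forall>i\<in>I. w i \<in> FSstar" and sum: "(\<Sum>i\<in>I. w i * Lam i) = 0" and i: "i \<in> I"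
  have "\<exists>S c. finite S \<and> 0 \<notin> S \<and> w i = (\<lambda>k. \<Sum>a\<in>S. c a * a ^ k)" if "i \<in> I" for i
    using I that FSstar_obtain by metis
  then obtain S c where S: "\<And>i. i \<in> I \<Longrightarrow> finite (S i)" "\<And>i. i \<in> I \<Longrightarrow> 0 \<notin> S i"
    and w: "\<And>i. i \<in> I \<Longrightarrow> w i = (\<lambda>k. \<Sum>a\<in>S i. c i a * a ^ k)"
    by metis
  define T where "T = (\<Union>i\<in>I. S i)"
  define C where "C a i = (if a \<in> S i then c i a else 0)" for a i
  have T: "finite T" "0 \<notin> T" using S I by (auto simp: T_def)
  have w': "w i k = (\<Sum>a\<in>T. C a i * a ^ k)" if "i \<in> I" for i k
    unfolding w[OF that] using that S T(1)
    by (intro sum.mono_neutral_cong_left) (auto simp: T_def C_def)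
  have "C a i = 0" if "a \<in> T" for a
  proof (rule geom_binom_independent[OF T I(1) _ that i])
    fix n :: int assume "n \<ge> 0"
    then obtain k where n: "n = int k" using zero_le_imp_eq_int by blast
    have "(\<Sum>a\<in>T. \<Sum>j\<in>I. C a j * geom_binom a j n) = (\<Sum>j\<in>I. w j k * Lam j k)"
      by (subst sum.swap)
        (simp add: n w' geom_binom_def Lam_def binomial_gbinomial sum_distrib_right mult.assoc)
    also have "\<dots> = (\<Sum>j\<in>I. w j * Lam j) k"
      using I(1) by (induction I rule: finite_induct) simp_all
    finally show "(\<Sum>a\<in>T. \<Sum>j\<in>I. C a j * geom_binom a j n) = 0" by (simp add: sum)
  qed
  then show "w i = 0" using w'[OF i] by (simp add: fun_eq_iff)
qed

lemma module_coords_eq: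
  assumes R: "0 \<in> R" "\<And>x y. x \<in> R \<Longrightarrow> y \<in> R \<Longrightarrow> x - y \<in> R"
    and V: "module_independent R V"
    and w: "\<And>i. w i \<in> R" "finite {i. w i \<noteq> 0}" "x = (\<Sum>i | w i \<noteq> 0. w i * V i)"
  shows "module_coords R V x = w"
  unfolding module_coords_def
proof (rule the_equality)
  show "(\<forall>i. w i \<in> R) \<and> finite {i. w i \<noteq> 0} \<and> x = (\<Sum>i | w i \<noteq> 0. w i * V i)"
    using w by blast
next
  fix w' assume "(\<forall>i. w' i \<in> R) \<and> finite {i. w' i \<noteq> 0} \<and> x = (\<Sum>i | w' i \<noteq> 0. w' i * V i)"
  then have w': "\<And>i. w' i \<in> R" "finite {i. w' i \<noteq> 0}" "x = (\<Sum>i | w' i \<noteq> 0. w' i * V i)"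
    by blast+
  define I where "I = {i. w i \<noteq> 0} \<union> {i. w' i \<noteq> 0}"
  have I: "finite I" using w w' by (simp add: I_def)
  have "x = (\<Sum>i\<in>I. w i * V i)"
    unfolding w(3) by (rule sum.mono_neutral_left) (use I in \<open>auto simp: I_def\<close>)
  moreover have "x = (\<Sum>i\<in>I. w' i * V i)"
    unfolding w'(3) by (rule sum.mono_neutral_left) (use I in \<open>auto simp: I_def\<close>)
  ultimately have "(\<Sum>i\<in>I. (w' i - w i) * V i) = 0"
    by (simp add: left_diff_distrib sum_subtractf)
  with V[unfolded module_independent_def, rule_format, of I "\<lambda>i. w' i - w i"] I R(2)[OF w'(1) w(1)]
  have *: "w' i - w i = 0" if "i \<in> I" for i using that by simp
  show "w' = w"
  proof
    show "w' i = w i" for i using *[of i] by (cases "i \<in> I") (auto simp: I_def)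
  qed
qed

text \<open>The constant coefficients \<open>c j\<close>, viewed as elements of \<open>FSstar\<close>, are the coordinates relative to \<open>Lam\<close>, and
  \<open>theta\<close> fixes constants.\<close>

lemma theta_tilde_sum:
  assumes J: "finite J"
  shows "theta_tilde (\<lambda>k. \<Sum>j\<in>J. c j * Lam j k) = (\<lambda>k. \<Sum>j\<in>J. c j * Lam_neg j k)"
proof -
  define w :: "nat \<Rightarrow> nat \<Rightarrow> 'a" where "w j = (\<lambda>k. if j \<in> J then c j else 0)" for j
  have nz: "{j. w j \<noteq> 0} = {j\<in>J. c j \<noteq> 0}" by (auto simp: w_def fun_eq_iff)
  have sum_w: "(\<lambda>k. \<Sum>j\<in>J. c j * V j k) = (\<Sum>j | w j \<noteq> 0. w j * V j)" for V :: "nat \<Rightarrow> nat \<Rightarrow> 'a"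
  proof -
    have "(\<Sum>j\<in>K. w j * V j) k = (\<Sum>j\<in>K. w j k * V j k)" for K k
      by (induction K rule: infinite_finite_induct) simp_all
    moreover have "(\<Sum>j\<in>J. c j * V j k) = (\<Sum>j\<in>{j\<in>J. c j \<noteq> 0}. w j k * V j k)" for k
      by (rule sum.mono_neutral_cong_right) (use J in \<open>auto simp: w_def\<close>)
    ultimately show ?thesis by (intro ext) (simp only: nz)
  qed
  have "module_coords FSstar Lam (\<lambda>k. \<Sum>j\<in>J. c j * Lam j k) = w"
  proof (rule module_coords_eq)
    show "x - y \<in> FSstar" if "x \<in> FSstar" "y \<in> FSstar" for x y :: "nat \<Rightarrow> 'a"
      using that unfolding FSstar_def by (rule seq.span_diff)
    show "w i \<in> FSstar" for i unfolding w_def by (rule const_in_FSstar)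
    show "0 \<in> FSstar" unfolding FSstar_def by (rule seq.span_zero)
    show "finite {j. w j \<noteq> 0}" using J by (simp only: nz) simp
  qed (rule module_independent_Lam sum_w)+
  moreover have "theta (w j) = w j" for j unfolding w_def by (rule theta_const)
  ultimately show ?thesis by (simp add: theta_tilde_def sum_w)
qed

text \<open>The binomial polynomial \<open>X (X - 1) \<dots> (X - j + 1) / j!\<close>.\<close>

definition binom_poly :: "nat \<Rightarrow> 'a::field_char_0 poly" where
  "binom_poly j = Polynomial.smult (inverse (fact j)) (\<Prod>i<j. [:- of_nat i, 1:])"

lemma poly_binom_poly: "poly (binom_poly j) x = x gchoose j"
  by (simp add: binom_poly_def poly_prod gbinomial_prod_rev atLeast0LessThan field_simps)

text \<open>Plugging \<open>-k\<close> for \<open>k\<close> in the geometric part, for \<open>F\<close>-combinations \<open>U i\<close> of binomial sequences. The common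
  annihilator of the entries of the continued geometric part \<open>g\<close> serves twice: it yields an annihilating
  polynomial of \<open>A\<close>, and it forces \<open>g\<close> to coincide with the two-sided orbit of \<open>drazin_orbit\<close>.\<close>

lemma canonical_form_at_negatives:
  fixes U :: "nat \<Rightarrow> nat \<Rightarrow> 'a::field_char_0" and P :: "nat \<Rightarrow> 'a poly"
  assumes U: "\<And>i. U i = (\<lambda>k. poly (P i) (of_nat k))"
    and P: "\<And>i x. poly (P i) x = (\<Sum>j\<in>J i. c i j * (x gchoose j))" and J: "\<And>i. finite (J i)"
    and A: "A \<in> carrier_mat q q" and can: "P_canonical_form U q A N m B"
  shows "mat_lincomb q m (\<lambda>i. map_mat theta (B i)) (\<lambda>i k. poly (P i) (- of_nat k)) =
        seq_mat q (\<lambda>k. drazin_inverse A ^\<^sub>m k - zero_seq 0 k \<cdot>\<^sub>m spectral_projection_0 A)"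
proof -
  from can have N: "N \<in> carrier_mat q q" "elements_mat N \<subseteq> FScirc"
    and B: "\<And>i. i \<le> m \<Longrightarrow> B i \<in> carrier_mat q q" "\<And>i. i \<le> m \<Longrightarrow> elements_mat (B i) \<subseteq> FSstar"
    and eq: "seq_mat q (\<lambda>k. A ^\<^sub>m k) = N + mat_lincomb q m B U"
    by (auto simp: P_canonical_form_def mat_over_def)
  have N_entry: "N $$ (a, b) \<in> FScirc" if "a < q" "b < q" for a b
    using N that by blast
  have B_entry: "B i $$ (a, b) \<in> FSstar" if "i \<le> m" "a < q" "b < q" for i a b
    using B[OF that(1)] that by blast
  obtain E :: "(nat \<Rightarrow> 'a) \<Rightarrow> int \<Rightarrow> 'a" where
    E: "\<And>f k. f \<in> FSstar \<Longrightarrow> E f (int k) = f k" "\<And>f k. f \<in> FSstar \<Longrightarrow> E f (- int k) = theta f k"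
      "\<And>f j. f \<in> FSstar \<Longrightarrow> linrec (\<lambda>n. E f n * (of_int n gchoose j))"
    using FSstar_extension by metis
  \<comment> \<open>The entries of the geometric part, continued to all integers.\<close>
  define g where "g = (\<lambda>(a, b) n. \<Sum>i\<le>m. E (B i $$ (a, b)) n * poly (P i) (of_int n))"
  have rec: "linrec (g ab)" if "ab \<in> {..<q} \<times> {..<q}" for ab
  proof -
    obtain a b where "ab = (a, b)" by (cases ab)
    with that have ab: "ab = (a, b)" "a < q" "b < q" by auto
    have "linrec (\<lambda>n. E (B i $$ (a, b)) n * poly (P i) (of_int n))" if "i \<le> m" for i
    proof -
      have "linrec (\<lambda>n. \<Sum>j\<in>J i. c i j * (E (B i $$ (a, b)) n * (of_int n gchoose j)))"
        using B_entry ab that J by (intro linrec_lincomb E(3)) auto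
      then show ?thesis by (simp add: P sum_distrib_left mult.left_commute)
    qed
    then have "linrec (\<lambda>n. \<Sum>i\<le>m. 1 * (E (B i $$ (a, b)) n * poly (P i) (of_int n)))"
      by (intro linrec_lincomb) auto
    then show ?thesis by (simp add: g_def ab)
  qed
  obtain S d where S: "finite S" "0 \<notin> S"
    and g0': "\<forall>ab\<in>{..<q} \<times> {..<q}. shift_act (split_poly S d) (g ab) = (\<lambda>n. 0)"
    using linrec_common[of "{..<q} \<times> {..<q}" g] rec by blast
  have g0: "shift_act (split_poly S d) (g (a, b)) = (\<lambda>n. 0)" if "a < q" "b < q" for a b
    using g0' that by simp
  have "eventually (\<lambda>k. \<forall>ab\<in>{..<q} \<times> {..<q}. (N $$ ab) k = 0) sequentially"
    by (intro eventually_ball_finite) (auto intro!: FScirc_eventually_0 N_entry)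
  then obtain r where r: "\<And>a b k. a < q \<Longrightarrow> b < q \<Longrightarrow> k \<ge> r \<Longrightarrow> (N $$ (a, b)) k = 0"
    by (auto simp: eventually_sequentially)
  have pow: "(A ^\<^sub>m k) $$ (a, b) = g (a, b) (int k)" if "a < q" "b < q" "k \<ge> r" for a b k
  proof -
    have "(A ^\<^sub>m k) $$ (a, b) = (seq_mat q (\<lambda>k. A ^\<^sub>m k) $$ (a, b)) k"
      using that by (simp add: seq_mat_def)
    also have "\<dots> = (\<Sum>i\<le>m. B i $$ (a, b) * U i) k"
      using that N r by (simp add: eq mat_lincomb_def)
    also have "\<dots> = (\<Sum>i\<le>m. (B i $$ (a, b)) k * U i k)"
      by (induction m) simp_all
    also have "\<dots> = g (a, b) (int k)"
      using that by (simp add: g_def E(1) B_entry U)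
    finally show ?thesis .
  qed
  \<comment> \<open>From the index \<open>r\<close> on, the powers of \<open>A\<close> obey the recurrence of \<open>g\<close>.\<close>
  have ann: "poly_mat A (split_poly S d) * A ^\<^sub>m r = 0\<^sub>m q q"
  proof (rule eq_matI)
    fix a b assume "a < dim_row (0\<^sub>m q q :: 'a mat)" "b < dim_col (0\<^sub>m q q :: 'a mat)"
    then have ab: "a < q" "b < q" by auto
    have "(poly_mat A (split_poly S d) * A ^\<^sub>m r) $$ (a, b)
        = shift_act (split_poly S d) (\<lambda>k. (A ^\<^sub>m nat k) $$ (a, b)) (int r)"
      using shift_act_orbit[OF A, of 0 "\<lambda>k. A ^\<^sub>m nat k" a b "int r"] ab A
      by (simp add: nat_add_distrib pow_mat_Suc_left[OF A] pow_carrier_mat del: pow_mat.simps(2))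
    also have "\<dots> = shift_act (split_poly S d) (g (a, b)) (int r)"
      by (rule shift_act_cong) (use ab pow[of a b "nat _"] in auto)
    finally show "(poly_mat A (split_poly S d) * A ^\<^sub>m r) $$ (a, b) = 0\<^sub>m q q $$ (a, b)"
      using g0 ab by simp
  qed (use A in \<open>simp_all add: pow_mat_dim_square\<close>)
  obtain G where G: "\<And>k. G k \<in> carrier_mat q q" "\<And>k. G (k + 1) = A * G k"
      "\<And>k. poly_mat A (split_poly S d) * G k = 0\<^sub>m q q" "\<And>k. k > r \<Longrightarrow> G (int k) = A ^\<^sub>m k"
      "\<And>k. G (- int k) = drazin_inverse A ^\<^sub>m k - zero_seq 0 k \<cdot>\<^sub>m spectral_projection_0 A"
    using drazin_orbit[OF A S ann] by metis
  have gG: "g (a, b) n = G n $$ (a, b)" if ab: "a < q" "b < q" for a b n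
  proof -
    have "(\<lambda>n. g (a, b) n - G n $$ (a, b)) = (\<lambda>n. 0)"
    proof (rule shift_act_split_poly_eq_0[OF S])
      have "shift_act (split_poly S d) (\<lambda>k. G k $$ (a, b)) n = 0" for n
        using shift_act_orbit[OF A, of n G a b n] G ab by simp
      then show "shift_act (split_poly S d) (\<lambda>n. g (a, b) n - G n $$ (a, b)) = (\<lambda>n. 0)"
        using g0[OF ab] by (simp add: fun_eq_iff shift_act_diff)
      show "g (a, b) n - G n $$ (a, b) = 0" if "n \<ge> int r + 1" for n
        using that pow[OF ab, of "nat n"] G(4)[of "nat n"] by simp
    qed
    then show ?thesis by (simp add: fun_eq_iff)
  qed
  show ?thesis
  proof (rule eq_matI)
    fix a b
    assume "a < dim_row (seq_mat q (\<lambda>k. drazin_inverse A ^\<^sub>m k - zero_seq 0 k \<cdot>\<^sub>m spectral_projection_0 A))"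
      and "b < dim_col (seq_mat q (\<lambda>k. drazin_inverse A ^\<^sub>m k - zero_seq 0 k \<cdot>\<^sub>m spectral_projection_0 A))"
    then have ab: "a < q" "b < q" by (simp_all add: seq_mat_def)
    have "(mat_lincomb q m (\<lambda>i. map_mat theta (B i)) (\<lambda>i k. poly (P i) (- of_nat k)) $$ (a, b)) k
        = (drazin_inverse A ^\<^sub>m k - zero_seq 0 k \<cdot>\<^sub>m spectral_projection_0 A) $$ (a, b)" for k
    proof -
      have "(mat_lincomb q m (\<lambda>i. map_mat theta (B i)) (\<lambda>i k. poly (P i) (- of_nat k)) $$ (a, b)) k
          = (\<Sum>i\<le>m. theta (B i $$ (a, b)) * (\<lambda>k. poly (P i) (- of_nat k))) k"
        using ab carrier_matD[OF B(1)] by (simp add: mat_lincomb_def cong: sum.cong_simp)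
      also have "\<dots> = (\<Sum>i\<le>m. theta (B i $$ (a, b)) k * poly (P i) (- of_nat k))"
        by (induction m) simp_all
      also have "\<dots> = g (a, b) (- int k)"
        using ab by (simp add: g_def E(2) B_entry)
      also have "\<dots> = (drazin_inverse A ^\<^sub>m k - zero_seq 0 k \<cdot>\<^sub>m spectral_projection_0 A) $$ (a, b)"
        unfolding gG[OF ab] G(5) ..
      finally show ?thesis .
    qed
    then show "mat_lincomb q m (\<lambda>i. map_mat theta (B i)) (\<lambda>i k. poly (P i) (- of_nat k)) $$ (a, b)
        = seq_mat q (\<lambda>k. drazin_inverse A ^\<^sub>m k - zero_seq 0 k \<cdot>\<^sub>m spectral_projection_0 A) $$ (a, b)"
      using ab by (simp add: seq_mat_def fun_eq_iff)
  qed (simp_all add: mat_lincomb_def seq_mat_def)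
qed

theorem theorem4p4:
  fixes U :: "nat \<Rightarrow> nat \<Rightarrow> 'a::field_char_0"
  assumes "module_basis FSstar FSstarT U"
    and "range U \<subseteq> seq.span T_set"
  shows "\<exists>P :: nat \<Rightarrow> 'a poly.
     (\<forall>i. U i = (\<lambda>k. poly (P i) (of_nat k))) \<and>
     (\<forall>i. theta_tilde (U i) = (\<lambda>k. poly (P i) (- of_nat k))) \<and>
     (\<forall>q (A :: 'a mat) N m B.
        A \<in> carrier_mat q q \<and> splits (char_poly A) \<and> P_canonical_form U q A N m B \<longrightarrow>
        mat_lincomb q m (\<lambda>i. map_mat theta (B i)) (\<lambda>i k. poly (P i) (- of_nat k)) =
        seq_mat q (\<lambda>k. drazin_inverse A ^\<^sub>m k - zero_seq 0 k \<cdot>\<^sub>m spectral_projection_0 A))"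
proof -
  have "\<exists>J c. finite J \<and> U i = (\<lambda>k. \<Sum>j\<in>J. c j * Lam j k)" for i
  proof -
    have "U i \<in> seq.span (range Lam)" using assms(2) by (auto simp: T_set_def)
    then obtain J c where "finite J" "U i = (\<lambda>k. \<Sum>j\<in>J. c j * Lam j k)"
      by (rule span_image_obtain)
    then show ?thesis by blast
  qed
  then obtain J c where J: "\<And>i. finite (J i)" and Ui: "\<And>i. U i = (\<lambda>k. \<Sum>j\<in>J i. c i j * Lam j k)"
    by metis
  define P where "P i = (\<Sum>j\<in>J i. Polynomial.smult (c i j) (binom_poly j))" for i
  have P: "poly (P i) x = (\<Sum>j\<in>J i. c i j * (x gchoose j))" for i x
    by (simp add: P_def poly_sum poly_binom_poly)
  have U: "U i = (\<lambda>k. poly (P i) (of_nat k))" for i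
    by (simp add: Ui P Lam_def binomial_gbinomial)
  have theta_U: "theta_tilde (U i) = (\<lambda>k. poly (P i) (- of_nat k))" for i
    by (simp add: Ui theta_tilde_sum[OF J] P Lam_neg_def)
  show ?thesis
    by (intro exI[of _ P] conjI allI impI U theta_U, elim conjE)
      (rule canonical_form_at_negatives[OF U P J])
qed

end
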